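(* For any $m,n\in\mathbb{N}$, there are bipointed maps $\iota_{m,n}:\square^m\vee\square^n\to\square^m\otimes^{\mathrm{lax}}\square^n$ and $\rho_{m,n}:\square^m\otimes^{\mathrm{lax}}\square^n\to\square^m\vee\square^n$ with $\rho_{m,n}\circ\iota_{m,n}=\mathrm{id}$. That is, they exhibit the wedge sum $\square^m\vee\square^n$ (of the naturally bipointed cubes) as a retract, in the category of bipointed strict $\omega$-categories, of the naturally bipointed cube $\square^{m+n}=\square^m\otimes^{\mathrm{lax}}\square^n$.
   Context: $\mathsf{sCat}_\omega$ is the 1-category of strict $\omega$-categories and strict functors. $\otimes^{\mathrm{lax}}$ is the (lax) Gray tensor product, a biclosed monoidal structure on $\mathsf{sCat}_\omega$; it is the essentially unique such structure which, on $\omega$-categories $\nu(K),\nu(L)$ associated to augmented directed complexes $K,L$ with strongly loop-free unital bases (Steiner complexes), is given by $\nu(K\otimes L)$, with $K\otimes L$ the usual tensor product of chain complexes, $d(x\otimes y)=dx\otimes y+(-1)^{|x|}x\otimes dy$, with basis the products of basis elements. Its unit is the terminal $\omega$-category $\square^0$. $\square^1=\{0\to1\}$ is the arrow category, and $\square^n=(\square^1)^{\otimes^{\mathrm{lax}}n}$ is the $n$-cube. The objects of $\square^n$ are the elements of $\{0,1\}^n$; write $\vec0=(0,\dots,0)$, $\vec1=(1,\dots,1)$. A bipointed strict $\omega$-category is a strict $\omega$-category $C$ with an ordered pair of objects (maps $\square^0\rightrightarrows C$), a first point and a second point; bipointed maps are functors preserving both points. The category of these is $\mathsf{sCat}_{\omega,*,*}$.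 The natural bipointing of $\square^n$ is $(\vec0,\vec1)$. For bipointed $C,D$, the wedge sum $C\vee D$ is the pushout $C\cup_{\square^0}D$ in $\mathsf{sCat}_\omega$ gluing the second point of $C$ to the first point of $D$, bipointed by the first point of $C$ and the second point of $D$. *)

theory Defs
  imports Main "HOL-Library.FuncSet" "HOL-Library.Poly_Mapping"
begin

section \<open>Strict omega-categories\<close>

text \<open>
  We use the one-sorted presentation of Street and Steiner.  A strict omega-category is a set of
  cells with operations \<open>bd Minus n\<close> (\<open>n\<close>-source), \<open>bd Plus n\<close> (\<open>n\<close>-target) and partial
  compositions \<open>comp n\<close>.  An \<open>n\<close>-cell is a cell fixed by \<open>bd \<alpha> n\<close>, so that cells are identified
  with the identities on them; objects are the \<open>0\<close>-cells.  Composition is written in diagrammatic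
  order: \<open>comp n x y\<close> is meaningful when the \<open>n\<close>-target of \<open>x\<close> is the \<open>n\<close>-source of \<open>y\<close>.
\<close>

datatype polarity = Minus | Plus

record 'a ocat =
  cells :: "'a set"
  bd :: "polarity \<Rightarrow> nat \<Rightarrow> 'a \<Rightarrow> 'a"
  comp :: "nat \<Rightarrow> 'a \<Rightarrow> 'a \<Rightarrow> 'a"

definition composable :: "('a, 'm) ocat_scheme \<Rightarrow> nat \<Rightarrow> 'a \<Rightarrow> 'a \<Rightarrow> bool" where
  "composable C n x y \<longleftrightarrow> x \<in> cells C \<and> y \<in> cells C \<and> bd C Plus n x = bd C Minus n y"

locale strict_omega_category =
  fixes C :: "('a, 'm) ocat_scheme"
  assumes bd_closed: "x \<in> cells C \<Longrightarrow> bd C \<alpha> n x \<in> cells C"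
    and comp_closed: "composable C n x y \<Longrightarrow> comp C n x y \<in> cells C"
    and bd_bd_less: "x \<in> cells C \<Longrightarrow> m < n \<Longrightarrow> bd C \<beta> m (bd C \<alpha> n x) = bd C \<beta> m x"
    and bd_bd_ge: "x \<in> cells C \<Longrightarrow> n \<le> m \<Longrightarrow> bd C \<beta> m (bd C \<alpha> n x) = bd C \<alpha> n x"
    and finite_dim: "x \<in> cells C \<Longrightarrow> \<exists>n. \<forall>\<alpha>. bd C \<alpha> n x = x"
    and unit_left: "x \<in> cells C \<Longrightarrow> comp C n (bd C Minus n x) x = x"
    and unit_right: "x \<in> cells C \<Longrightarrow> comp C n x (bd C Plus n x) = x"
    and bd_comp_less: "composable C n x y \<Longrightarrow> m < n \<Longrightarrow> bd C \<alpha> m (comp C n x y) = bd C \<alpha> m x"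
    and source_comp: "composable C n x y \<Longrightarrow> bd C Minus n (comp C n x y) = bd C Minus n x"
    and target_comp: "composable C n x y \<Longrightarrow> bd C Plus n (comp C n x y) = bd C Plus n y"
    and bd_comp_greater: "composable C n x y \<Longrightarrow> n < m \<Longrightarrow>
      bd C \<alpha> m (comp C n x y) = comp C n (bd C \<alpha> m x) (bd C \<alpha> m y)"
    and comp_assoc: "composable C n x y \<Longrightarrow> composable C n y z \<Longrightarrow>
      comp C n (comp C n x y) z = comp C n x (comp C n y z)"
    and interchange: "m < n \<Longrightarrow> composable C n x y \<Longrightarrow> composable C n x' y' \<Longrightarrow>
      composable C m x x' \<Longrightarrow> composable C m y y' \<Longrightarrow>
      comp C m (comp C n x y) (comp C n x' y') = comp C n (comp C m x x') (comp C m y y')"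

definition is_object :: "('a, 'm) ocat_scheme \<Rightarrow> 'a \<Rightarrow> bool" where
  "is_object C p \<longleftrightarrow> p \<in> cells C \<and> (\<forall>\<alpha>. bd C \<alpha> 0 p = p)"

text \<open>Identities are preserved automatically, since \<open>n\<close>-cells are singled out by \<open>bd\<close>.\<close>

definition strict_functor ::
    "('a, 'm) ocat_scheme \<Rightarrow> ('b, 'k) ocat_scheme \<Rightarrow> ('a \<Rightarrow> 'b) \<Rightarrow> bool" where
  "strict_functor C D F \<longleftrightarrow> strict_omega_category C \<and> strict_omega_category D \<and>
     F \<in> cells C \<rightarrow> cells D \<and>
     (\<forall>\<alpha> n. \<forall>x\<in>cells C. F (bd C \<alpha> n x) = bd D \<alpha> n (F x)) \<and>
     (\<forall>n x y. composable C n x y \<longrightarrow> F (comp C n x y) = comp D n (F x) (F y))"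

record 'a bipointed_ocat = "'a ocat" +
  first_pt :: 'a
  second_pt :: 'a

definition bipoint :: "'a ocat \<Rightarrow> 'a \<Rightarrow> 'a \<Rightarrow> 'a bipointed_ocat" where
  "bipoint C p q = ocat.extend C \<lparr>first_pt = p, second_pt = q\<rparr>"

definition bipointed :: "('a, 'm) bipointed_ocat_scheme \<Rightarrow> bool" where
  "bipointed C \<longleftrightarrow> strict_omega_category C \<and> is_object C (first_pt C) \<and> is_object C (second_pt C)"

definition bipointed_map ::
    "('a, 'm) bipointed_ocat_scheme \<Rightarrow> ('b, 'k) bipointed_ocat_scheme \<Rightarrow> ('a \<Rightarrow> 'b) \<Rightarrow> bool" where
  "bipointed_map C D F \<longleftrightarrow> bipointed C \<and> bipointed D \<and> strict_functor C D F \<and>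
     F (first_pt C) = first_pt D \<and> F (second_pt C) = second_pt D"

definition bipointed_iso ::
    "('a, 'm) bipointed_ocat_scheme \<Rightarrow> ('b, 'k) bipointed_ocat_scheme \<Rightarrow> ('a \<Rightarrow> 'b) \<Rightarrow> bool" where
  "bipointed_iso C D F \<longleftrightarrow> bipointed_map C D F \<and> bij_betw F (cells C) (cells D)"


section \<open>Pushouts of strict omega-categories\<close>

text \<open>
  The pushout of \<open>C \<leftarrow> A \<rightarrow> D\<close> (along \<open>f\<close> and \<open>g\<close>) is presented by generators and relations: cells
  are formal expressions in the operations over the cells of \<open>C\<close> and \<open>D\<close>, modulo the least
  congruence forced by the axioms, by the operations of \<open>C\<close> and \<open>D\<close>, and by the gluing.
  As composition is partial, the congruence is a partial equivalence relation whose domain consists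
  of the well-formed expressions.  The universal property is theorem \<open>pushout_universal\<close> below.
\<close>

datatype ('a, 'b) expr =
  Inl_gen 'a | Inr_gen 'b | Bd polarity nat "('a, 'b) expr" | Comp nat "('a, 'b) expr" "('a, 'b) expr"

inductive push_eq ::
    "('c, 'l) ocat_scheme \<Rightarrow> ('c \<Rightarrow> 'a) \<Rightarrow> ('c \<Rightarrow> 'b) \<Rightarrow>
     ('a, 'm) ocat_scheme \<Rightarrow> ('b, 'k) ocat_scheme \<Rightarrow> ('a, 'b) expr \<Rightarrow> ('a, 'b) expr \<Rightarrow> bool"
  for A f g C D
where
  sym: "push_eq A f g C D t u \<Longrightarrow> push_eq A f g C D u t"
| trans: "push_eq A f g C D t u \<Longrightarrow> push_eq A f g C D u v \<Longrightarrow> push_eq A f g C D t v"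
| Bd_cong: "push_eq A f g C D t u \<Longrightarrow> push_eq A f g C D (Bd \<alpha> n t) (Bd \<alpha> n u)"
| Comp_cong: "push_eq A f g C D t t' \<Longrightarrow> push_eq A f g C D u u' \<Longrightarrow>
    push_eq A f g C D (Bd Plus n t) (Bd Minus n u) \<Longrightarrow>
    push_eq A f g C D (Comp n t u) (Comp n t' u')"
| Inl_refl: "x \<in> cells C \<Longrightarrow> push_eq A f g C D (Inl_gen x) (Inl_gen x)"
| Inl_bd: "x \<in> cells C \<Longrightarrow> push_eq A f g C D (Bd \<alpha> n (Inl_gen x)) (Inl_gen (bd C \<alpha> n x))"
| Inl_comp: "composable C n x y \<Longrightarrow>
    push_eq A f g C D (Comp n (Inl_gen x) (Inl_gen y)) (Inl_gen (comp C n x y))"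
| Inr_refl: "x \<in> cells D \<Longrightarrow> push_eq A f g C D (Inr_gen x) (Inr_gen x)"
| Inr_bd: "x \<in> cells D \<Longrightarrow> push_eq A f g C D (Bd \<alpha> n (Inr_gen x)) (Inr_gen (bd D \<alpha> n x))"
| Inr_comp: "composable D n x y \<Longrightarrow>
    push_eq A f g C D (Comp n (Inr_gen x) (Inr_gen y)) (Inr_gen (comp D n x y))"
| glue: "a \<in> cells A \<Longrightarrow> push_eq A f g C D (Inl_gen (f a)) (Inr_gen (g a))"
| Bd_Bd_less: "push_eq A f g C D t t \<Longrightarrow> m < n \<Longrightarrow>
    push_eq A f g C D (Bd \<beta> m (Bd \<alpha> n t)) (Bd \<beta> m t)"
| Bd_Bd_ge: "push_eq A f g C D t t \<Longrightarrow> n \<le> m \<Longrightarrow>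
    push_eq A f g C D (Bd \<beta> m (Bd \<alpha> n t)) (Bd \<alpha> n t)"
| Unit_left: "push_eq A f g C D t t \<Longrightarrow> push_eq A f g C D (Comp n (Bd Minus n t) t) t"
| Unit_right: "push_eq A f g C D t t \<Longrightarrow> push_eq A f g C D (Comp n t (Bd Plus n t)) t"
| Bd_Comp_less: "push_eq A f g C D t t \<Longrightarrow> push_eq A f g C D u u \<Longrightarrow>
    push_eq A f g C D (Bd Plus n t) (Bd Minus n u) \<Longrightarrow> m < n \<Longrightarrow>
    push_eq A f g C D (Bd \<alpha> m (Comp n t u)) (Bd \<alpha> m t)"
| Source_Comp: "push_eq A f g C D t t \<Longrightarrow> push_eq A f g C D u u \<Longrightarrow>
    push_eq A f g C D (Bd Plus n t) (Bd Minus n u) \<Longrightarrow>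
    push_eq A f g C D (Bd Minus n (Comp n t u)) (Bd Minus n t)"
| Target_Comp: "push_eq A f g C D t t \<Longrightarrow> push_eq A f g C D u u \<Longrightarrow>
    push_eq A f g C D (Bd Plus n t) (Bd Minus n u) \<Longrightarrow>
    push_eq A f g C D (Bd Plus n (Comp n t u)) (Bd Plus n u)"
| Bd_Comp_greater: "push_eq A f g C D t t \<Longrightarrow> push_eq A f g C D u u \<Longrightarrow>
    push_eq A f g C D (Bd Plus n t) (Bd Minus n u) \<Longrightarrow> n < m \<Longrightarrow>
    push_eq A f g C D (Bd \<alpha> m (Comp n t u)) (Comp n (Bd \<alpha> m t) (Bd \<alpha> m u))"
| Assoc: "push_eq A f g C D t t \<Longrightarrow> push_eq A f g C D u u \<Longrightarrow> push_eq A f g C D v v \<Longrightarrow>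
    push_eq A f g C D (Bd Plus n t) (Bd Minus n u) \<Longrightarrow>
    push_eq A f g C D (Bd Plus n u) (Bd Minus n v) \<Longrightarrow>
    push_eq A f g C D (Comp n (Comp n t u) v) (Comp n t (Comp n u v))"
| Interchange: "m < n \<Longrightarrow> push_eq A f g C D t t \<Longrightarrow> push_eq A f g C D u u \<Longrightarrow>
    push_eq A f g C D t' t' \<Longrightarrow> push_eq A f g C D u' u' \<Longrightarrow>
    push_eq A f g C D (Bd Plus n t) (Bd Minus n u) \<Longrightarrow>
    push_eq A f g C D (Bd Plus n t') (Bd Minus n u') \<Longrightarrow>
    push_eq A f g C D (Bd Plus m t) (Bd Minus m t') \<Longrightarrow>
    push_eq A f g C D (Bd Plus m u) (Bd Minus m u') \<Longrightarrow>
    push_eq A f g C D (Comp m (Comp n t u) (Comp n t' u')) (Comp n (Comp m t t') (Comp m u u'))"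

definition push_class ::
    "('c, 'l) ocat_scheme \<Rightarrow> ('c \<Rightarrow> 'a) \<Rightarrow> ('c \<Rightarrow> 'b) \<Rightarrow>
     ('a, 'm) ocat_scheme \<Rightarrow> ('b, 'k) ocat_scheme \<Rightarrow> ('a, 'b) expr \<Rightarrow> ('a, 'b) expr set" where
  "push_class A f g C D t = {u. push_eq A f g C D t u}"

definition pushout ::
    "('c, 'l) ocat_scheme \<Rightarrow> ('c \<Rightarrow> 'a) \<Rightarrow> ('c \<Rightarrow> 'b) \<Rightarrow>
     ('a, 'm) ocat_scheme \<Rightarrow> ('b, 'k) ocat_scheme \<Rightarrow> ('a, 'b) expr set ocat" where
  "pushout A f g C D =
    \<lparr>cells = {push_class A f g C D t | t. push_eq A f g C D t t},
     bd = (\<lambda>\<alpha> n X. \<Union>t\<in>X. push_class A f g C D (Bd \<alpha> n t)),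
     comp = (\<lambda>n X Y. \<Union>t\<in>X. \<Union>u\<in>Y. push_class A f g C D (Comp n t u))\<rparr>"

abbreviation push_inl where "push_inl A f g C D x \<equiv> push_class A f g C D (Inl_gen x)"
abbreviation push_inr where "push_inr A f g C D y \<equiv> push_class A f g C D (Inr_gen y)"

context
  fixes A :: "('c, 'l) ocat_scheme" and f :: "'c \<Rightarrow> 'a" and g :: "'c \<Rightarrow> 'b"
    and C :: "('a, 'm) ocat_scheme" and D :: "('b, 'k) ocat_scheme"
begin

private abbreviation (input) eqv (infix "\<approx>" 50) where "t \<approx> u \<equiv> push_eq A f g C D t u"
private abbreviation (input) cls where "cls t \<equiv> push_class A f g C D t"
private abbreviation (input) P where "P \<equiv> pushout A f g C D"

lemma push_eq_refl1: "t \<approx> u \<Longrightarrow> t \<approx> t"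
  by (blast intro: push_eq.sym push_eq.trans)

lemma push_eq_refl2: "t \<approx> u \<Longrightarrow> u \<approx> u"
  by (blast intro: push_eq.sym push_eq.trans)

lemma push_class_eq_iff: "t \<approx> t \<Longrightarrow> cls t = cls u \<longleftrightarrow> t \<approx> u"
  unfolding push_class_def by (blast intro: push_eq.sym push_eq.trans)

lemma push_class_eqI: "t \<approx> u \<Longrightarrow> cls t = cls u"
  using push_class_eq_iff push_eq_refl1 by blast

lemma pushout_cells: "X \<in> cells P \<longleftrightarrow> (\<exists>t. t \<approx> t \<and> X = cls t)"
  by (auto simp: pushout_def)

lemma pushout_cellsI: "t \<approx> t \<Longrightarrow> cls t \<in> cells P"
  using pushout_cells by blast

lemma pushout_bd: assumes "t \<approx> t" shows "bd P \<alpha> n (cls t) = cls (Bd \<alpha> n t)"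
proof -
  have *: "cls (Bd \<alpha> n u) = cls (Bd \<alpha> n t)" if "u \<in> cls t" for u
  proof -
    have "t \<approx> u" using that by (simp add: push_class_def)
    then show ?thesis by (rule push_class_eqI[OF push_eq.Bd_cong, symmetric])
  qed
  have t: "t \<in> cls t" using assms by (simp add: push_class_def)
  have "bd P \<alpha> n (cls t) = (\<Union>u\<in>cls t. cls (Bd \<alpha> n u))" by (simp add: pushout_def)
  also have "\<dots> = (\<Union>u\<in>cls t. cls (Bd \<alpha> n t))" by (rule SUP_cong[OF refl *])
  also have "\<dots> = cls (Bd \<alpha> n t)" using t by blast
  finally show ?thesis .
qed

lemma pushout_composable:
  assumes "t \<approx> t" "u \<approx> u"
  shows "composable P n (cls t) (cls u) \<longleftrightarrow> Bd Plus n t \<approx> Bd Minus n u"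
  unfolding composable_def
  by (simp add: assms pushout_cellsI pushout_bd push_class_eq_iff push_eq.Bd_cong)

lemma pushout_comp:
  assumes "t \<approx> t" "u \<approx> u" "Bd Plus n t \<approx> Bd Minus n u"
  shows "comp P n (cls t) (cls u) = cls (Comp n t u)"
proof -
  have *: "cls (Comp n t' u') = cls (Comp n t u)" if "t' \<in> cls t" "u' \<in> cls u" for t' u'
  proof -
    have "t \<approx> t'" "u \<approx> u'" using that by (auto simp: push_class_def)
    then have "Comp n t u \<approx> Comp n t' u'" using assms(3) by (rule push_eq.Comp_cong)
    then show ?thesis by (rule push_class_eqI[symmetric])
  qed
  have tu: "t \<in> cls t" "u \<in> cls u" using assms by (simp_all add: push_class_def)
  have "comp P n (cls t) (cls u) = (\<Union>t'\<in>cls t. \<Union>u'\<in>cls u. cls (Comp n t' u'))"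
    by (simp add: pushout_def)
  also have "\<dots> = (\<Union>t'\<in>cls t. \<Union>u'\<in>cls u. cls (Comp n t u))"
    by (intro SUP_cong refl *)
  also have "\<dots> = cls (Comp n t u)" using tu by blast
  finally show ?thesis .
qed

lemma composable_pushoutE:
  assumes "composable P n X Y"
  obtains t u where "X = cls t" "Y = cls u" "t \<approx> t" "u \<approx> u" "Bd Plus n t \<approx> Bd Minus n u"
proof -
  have "X \<in> cells P" "Y \<in> cells P" using assms by (auto simp: composable_def)
  then obtain t u where "t \<approx> t" "X = cls t" "u \<approx> u" "Y = cls u" by (auto simp: pushout_cells)
  then show ?thesis using assms that[of t u] pushout_composable[of t u n] by simp
qed

lemma push_dim_mono:
  assumes "Bd \<alpha> n t \<approx> t" "n \<le> m" shows "Bd \<beta> m t \<approx> t"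
proof -
  have "t \<approx> t" using assms(1) by (rule push_eq_refl2)
  then have "Bd \<beta> m (Bd \<alpha> n t) \<approx> Bd \<alpha> n t" using assms(2) by (rule push_eq.Bd_Bd_ge)
  moreover have "Bd \<beta> m (Bd \<alpha> n t) \<approx> Bd \<beta> m t" using assms(1) by (rule push_eq.Bd_cong)
  ultimately have "Bd \<beta> m t \<approx> Bd \<alpha> n t" by (rule push_eq.trans[OF push_eq.sym, rotated])
  then show ?thesis using assms(1) by (rule push_eq.trans)
qed

end


primrec push_wf where
  "push_wf A f g C D (Inl_gen x) \<longleftrightarrow> x \<in> cells C"
| "push_wf A f g C D (Inr_gen y) \<longleftrightarrow> y \<in> cells D"
| "push_wf A f g C D (Bd \<alpha> n t) \<longleftrightarrow> push_wf A f g C D t"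
| "push_wf A f g C D (Comp n t u) \<longleftrightarrow> push_wf A f g C D t \<and> push_wf A f g C D u \<and>
     push_eq A f g C D (Bd Plus n t) (Bd Minus n u)"

lemma push_wf_refl: "push_wf A f g C D t \<Longrightarrow> push_eq A f g C D t t"
  by (induction t) (auto intro: push_eq.Inl_refl push_eq.Inr_refl push_eq.Bd_cong push_eq.Comp_cong)

lemma push_eq_wf:
  assumes C: "strict_omega_category C" and D: "strict_omega_category D"
    and f: "f \<in> cells A \<rightarrow> cells C" and g: "g \<in> cells A \<rightarrow> cells D"
    and tu: "push_eq A f g C D t u"
  shows "push_wf A f g C D t \<and> push_wf A f g C D u"
  using tu
proof (induction rule: push_eq.induct)
  case (Comp_cong t t' u u' n)
  have "push_eq A f g C D (Bd Plus n t') (Bd Minus n u')"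
    by (rule push_eq.trans[OF push_eq.Bd_cong[OF push_eq.sym[OF Comp_cong.hyps(1)]]
          push_eq.trans[OF Comp_cong.hyps(3) push_eq.Bd_cong[OF Comp_cong.hyps(2)]]])
  then show ?case using Comp_cong by simp
next
  case (Inl_bd x \<alpha> n)
  then show ?case using strict_omega_category.bd_closed[OF C] by simp
next
  case (Inr_bd x \<alpha> n)
  then show ?case using strict_omega_category.bd_closed[OF D] by simp
next
  case (Inl_comp n x y)
  have x: "x \<in> cells C" "y \<in> cells C" and b: "bd C Plus n x = bd C Minus n y"
    using Inl_comp by (auto simp: composable_def)
  have "push_eq A f g C D (Bd Plus n (Inl_gen x)) (Bd Minus n (Inl_gen y))"
    using push_eq.trans[OF push_eq.Inl_bd[OF x(1), of A f g D Plus n, unfolded b]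
        push_eq.sym[OF push_eq.Inl_bd[OF x(2)]]] .
  then show ?case using x strict_omega_category.comp_closed[OF C Inl_comp.hyps] by simp
next
  case (Inr_comp n x y)
  have x: "x \<in> cells D" "y \<in> cells D" and b: "bd D Plus n x = bd D Minus n y"
    using Inr_comp by (auto simp: composable_def)
  have "push_eq A f g C D (Bd Plus n (Inr_gen x)) (Bd Minus n (Inr_gen y))"
    using push_eq.trans[OF push_eq.Inr_bd[OF x(1), of A f g C Plus n, unfolded b]
        push_eq.sym[OF push_eq.Inr_bd[OF x(2)]]] .
  then show ?case using x strict_omega_category.comp_closed[OF D Inr_comp.hyps] by simp
next
  case (Unit_left t n)
  then show ?case using push_eq.Bd_Bd_ge[OF Unit_left.hyps, of n n Plus Minus] by simp
next
  case (Unit_right t n)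
  then show ?case using push_eq.sym[OF push_eq.Bd_Bd_ge[OF Unit_right.hyps, of n n Minus Plus]]
    by simp
next
  case (Bd_Comp_greater t u n m \<alpha>)
  have "push_eq A f g C D (Bd Plus n (Bd \<alpha> m t)) (Bd Minus n (Bd \<alpha> m u))"
    by (rule push_eq.trans[OF push_eq.Bd_Bd_less[OF Bd_Comp_greater.hyps(1,4)]
          push_eq.trans[OF Bd_Comp_greater.hyps(3)
            push_eq.sym[OF push_eq.Bd_Bd_less[OF Bd_Comp_greater.hyps(2,4)]]]])
  then show ?case using Bd_Comp_greater by simp
next
  case (Assoc t u v n)
  have "push_eq A f g C D (Bd Plus n (Comp n t u)) (Bd Minus n v)"
    by (rule push_eq.trans[OF push_eq.Target_Comp[OF Assoc.hyps(1,2,4)] Assoc.hyps(5)])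
  moreover have "push_eq A f g C D (Bd Plus n t) (Bd Minus n (Comp n u v))"
    by (rule push_eq.trans[OF Assoc.hyps(4) push_eq.sym[OF
          push_eq.Source_Comp[OF Assoc.hyps(2,3,5)]]])
  ultimately show ?case using Assoc by simp
next
  case (Interchange m n t u t' u')
  have 1: "push_eq A f g C D (Bd Plus m (Comp n t u)) (Bd Minus m (Comp n t' u'))"
    by (rule push_eq.trans[OF push_eq.Bd_Comp_less[OF Interchange.hyps(2,3,6,1)]
          push_eq.trans[OF Interchange.hyps(8)
            push_eq.sym[OF push_eq.Bd_Comp_less[OF Interchange.hyps(4,5,7,1)]]]])
  have low: "push_eq A f g C D (Bd Plus m (Bd Plus n t)) (Bd Minus m (Bd Plus n t'))"
    by (rule push_eq.trans[OF push_eq.Bd_Bd_less[OF Interchange.hyps(2,1)]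
          push_eq.trans[OF Interchange.hyps(8)
            push_eq.sym[OF push_eq.Bd_Bd_less[OF Interchange.hyps(4,1)]]]])
  have 2: "push_eq A f g C D (Bd Plus n (Comp m t t')) (Bd Minus n (Comp m u u'))"
    by (rule push_eq.trans[OF push_eq.Bd_Comp_greater[OF Interchange.hyps(2,4,8,1)]
          push_eq.trans[OF push_eq.Comp_cong[OF Interchange.hyps(6,7) low]
            push_eq.sym[OF push_eq.Bd_Comp_greater[OF Interchange.hyps(3,5,9,1)]]]])
  from 1 2 show ?case using Interchange by simp
next
  case (glue a)
  then show ?case using f g by auto
qed auto

lemma push_finite_dim:
  assumes C: "strict_omega_category C" and D: "strict_omega_category D"
  shows "push_wf A f g C D t \<Longrightarrow> \<exists>n. \<forall>\<alpha>. push_eq A f g C D (Bd \<alpha> n t) t"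
proof (induction t)
  case (Inl_gen x)
  then have x: "x \<in> cells C" by simp
  obtain n where "\<And>\<alpha>. bd C \<alpha> n x = x" using strict_omega_category.finite_dim[OF C x] by blast
  then show ?case using push_eq.Inl_bd[OF x, of A f g D _ n] by auto
next
  case (Inr_gen x)
  then have x: "x \<in> cells D" by simp
  obtain n where "\<And>\<alpha>. bd D \<alpha> n x = x" using strict_omega_category.finite_dim[OF D x] by blast
  then show ?case using push_eq.Inr_bd[OF x, of A f g C _ n] by auto
next
  case (Bd \<alpha> n t)
  then have "push_eq A f g C D t t" by (simp add: push_wf_refl)
  from push_eq.Bd_Bd_ge[OF this order_refl] show ?case by blast
next
  case (Comp n t u)
  then have rt: "push_eq A f g C D t t" and ru: "push_eq A f g C D u u"
    and tu: "push_eq A f g C D (Bd Plus n t) (Bd Minus n u)" by (simp_all add: push_wf_refl)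
  obtain i where i: "\<And>\<alpha>. push_eq A f g C D (Bd \<alpha> i t) t" using Comp by auto
  obtain j where j: "\<And>\<alpha>. push_eq A f g C D (Bd \<alpha> j u) u" using Comp by auto
  define N where "N = i + j + Suc n"
  have Nt: "push_eq A f g C D (Bd \<alpha> N t) t" for \<alpha>
    by (rule push_dim_mono[OF i]) (simp add: N_def)
  have Nu: "push_eq A f g C D (Bd \<alpha> N u) u" for \<alpha>
    by (rule push_dim_mono[OF j]) (simp add: N_def)
  have n: "n < N" by (simp add: N_def)
  have "push_eq A f g C D (Bd \<alpha> N (Comp n t u)) (Comp n t u)" for \<alpha>
    by (rule push_eq.trans[OF push_eq.Bd_Comp_greater[OF rt ru tu n]
          push_eq.sym[OF push_eq.Comp_cong[OF push_eq.sym[OF Nt] push_eq.sym[OF Nu] tu]]])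
  then show ?case by blast
qed

theorem pushout_omega_category:
  assumes C: "strict_omega_category C" and D: "strict_omega_category D"
    and f: "f \<in> cells A \<rightarrow> cells C" and g: "g \<in> cells A \<rightarrow> cells D"
  shows "strict_omega_category (pushout A f g C D)"
proof
  note [simp] = pushout_bd pushout_comp push_eq.Bd_cong pushout_cellsI push_eq.Comp_cong
    pushout_composable
  let ?P = "pushout A f g C D"
  let ?cls = "push_class A f g C D"
  fix X
  assume "X \<in> cells ?P"
  then obtain t where t: "push_eq A f g C D t t" and X: "X = ?cls t" by (auto simp: pushout_cells)
  show "bd ?P \<alpha> n X \<in> cells ?P" for \<alpha> n using t X by simp
  show "bd ?P \<beta> m (bd ?P \<alpha> n X) = bd ?P \<beta> m X" if "m < n" for \<alpha> \<beta> m n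
    using t X that by (simp add: push_class_eqI[OF push_eq.Bd_Bd_less])
  show "bd ?P \<beta> m (bd ?P \<alpha> n X) = bd ?P \<alpha> n X" if "n \<le> m" for \<alpha> \<beta> m n
    using t X that by (simp add: push_class_eqI[OF push_eq.Bd_Bd_ge])
  have "push_wf A f g C D t" using push_eq_wf[OF C D f g t] by blast
  from push_finite_dim[OF C D this] obtain n
    where n: "\<And>\<alpha>. push_eq A f g C D (Bd \<alpha> n t) t" by blast
  have "\<forall>\<alpha>. bd ?P \<alpha> n X = X" using t X by (simp add: push_class_eqI[OF n])
  then show "\<exists>n. \<forall>\<alpha>. bd ?P \<alpha> n X = X" by blast
  show "comp ?P n (bd ?P Minus n X) X = X" for n
    using t X push_eq.Bd_Bd_ge[OF t, of n n Plus Minus]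
    by (simp add: push_class_eqI[OF push_eq.Unit_left])
  show "comp ?P n X (bd ?P Plus n X) = X" for n
    using t X push_eq.sym[OF push_eq.Bd_Bd_ge[OF t, of n n Minus Plus]]
    by (simp add: push_class_eqI[OF push_eq.Unit_right])
next
  note [simp] = pushout_bd pushout_comp push_eq.Bd_cong pushout_cellsI push_eq.Comp_cong
    pushout_composable
  let ?P = "pushout A f g C D"
  let ?cls = "push_class A f g C D"
  fix n X Y
  assume XY: "composable ?P n X Y"
  then obtain t u where X: "X = ?cls t" and Y: "Y = ?cls u"
    and t: "push_eq A f g C D t t" and u: "push_eq A f g C D u u"
    and tu: "push_eq A f g C D (Bd Plus n t) (Bd Minus n u)" by (rule composable_pushoutE)
  have tu': "push_eq A f g C D (Comp n t u) (Comp n t u)" using t u tu by simp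
  show "comp ?P n X Y \<in> cells ?P" using t u tu X Y by simp
  show "bd ?P \<alpha> m (comp ?P n X Y) = bd ?P \<alpha> m X" if "m < n" for \<alpha> m
    using t u tu tu' X Y that by (simp add: push_class_eqI[OF push_eq.Bd_Comp_less])
  show "bd ?P Minus n (comp ?P n X Y) = bd ?P Minus n X"
    using t u tu tu' X Y by (simp add: push_class_eqI[OF push_eq.Source_Comp])
  show "bd ?P Plus n (comp ?P n X Y) = bd ?P Plus n Y"
    using t u tu tu' X Y by (simp add: push_class_eqI[OF push_eq.Target_Comp])
  show "bd ?P \<alpha> m (comp ?P n X Y) = comp ?P n (bd ?P \<alpha> m X) (bd ?P \<alpha> m Y)" if "n < m" for \<alpha> m
  proof -
    have "push_eq A f g C D (Bd Plus n (Bd \<alpha> m t)) (Bd Minus n (Bd \<alpha> m u))"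
      by (rule push_eq.trans[OF push_eq.Bd_Bd_less[OF t that]
            push_eq.trans[OF tu push_eq.sym[OF push_eq.Bd_Bd_less[OF u that]]]])
    then show ?thesis
      using t u tu tu' X Y that by (simp add: push_class_eqI[OF push_eq.Bd_Comp_greater])
  qed
  show "comp ?P n (comp ?P n X Y) Z = comp ?P n X (comp ?P n Y Z)" if "composable ?P n Y Z" for Z
  proof -
    obtain v where Z: "Z = ?cls v" and v: "push_eq A f g C D v v"
      using \<open>composable ?P n Y Z\<close> by (auto simp: composable_def pushout_cells)
    have uv: "push_eq A f g C D (Bd Plus n u) (Bd Minus n v)"
      using that Y Z u v by simp
    have a: "push_eq A f g C D (Bd Plus n (Comp n t u)) (Bd Minus n v)"
      by (rule push_eq.trans[OF push_eq.Target_Comp[OF t u tu] uv])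
    have b: "push_eq A f g C D (Bd Plus n t) (Bd Minus n (Comp n u v))"
      by (rule push_eq.trans[OF tu push_eq.sym[OF push_eq.Source_Comp[OF u v uv]]])
    have uv': "push_eq A f g C D (Comp n u v) (Comp n u v)" using u v uv by simp
    show ?thesis using t u tu tu' v uv uv' a b X Y Z by (simp add: push_class_eqI[OF push_eq.Assoc])
  qed
  show "comp ?P m (comp ?P n X Y) (comp ?P n X' Y') = comp ?P n (comp ?P m X X') (comp ?P m Y Y')"
    if mn: "m < n" and XY': "composable ?P n X' Y'" and XX: "composable ?P m X X'"
      and YY: "composable ?P m Y Y'" for m X' Y'
  proof -
    obtain t' u' where X': "X' = ?cls t'" and Y': "Y' = ?cls u'"
      and t': "push_eq A f g C D t' t'" and u': "push_eq A f g C D u' u'"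
      and tu2: "push_eq A f g C D (Bd Plus n t') (Bd Minus n u')"
      using XY' by (rule composable_pushoutE)
    have tt: "push_eq A f g C D (Bd Plus m t) (Bd Minus m t')" using XX X X' t t' by simp
    have uu: "push_eq A f g C D (Bd Plus m u) (Bd Minus m u')" using YY Y Y' u u' by simp
    note I = push_eq.Interchange[OF mn t u t' u' tu tu2 tt uu]
    have "push_wf A f g C D (Comp m (Comp n t u) (Comp n t' u'))"
      "push_wf A f g C D (Comp n (Comp m t t') (Comp m u u'))"
      using push_eq_wf[OF C D f g I] by blast+
    then have "push_eq A f g C D (Bd Plus m (Comp n t u)) (Bd Minus m (Comp n t' u'))"
      "push_eq A f g C D (Bd Plus n (Comp m t t')) (Bd Minus n (Comp m u u'))" by simp_all
    then show ?thesis
      using X Y X' Y' t u t' u' tu tu2 tt uu push_class_eqI[OF I] by simp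
  qed
qed

lemma push_inl_functor:
  assumes C: "strict_omega_category C" and D: "strict_omega_category D"
    and f: "f \<in> cells A \<rightarrow> cells C" and g: "g \<in> cells A \<rightarrow> cells D"
  shows "strict_functor C (pushout A f g C D) (push_inl A f g C D)"
  unfolding strict_functor_def
proof (intro conjI allI ballI impI)
  show "(\<lambda>x. push_inl A f g C D x) \<in> cells C \<rightarrow> cells (pushout A f g C D)"
    by (auto intro: pushout_cellsI push_eq.Inl_refl)
  show "push_inl A f g C D (bd C \<alpha> n x) = bd (pushout A f g C D) \<alpha> n (push_inl A f g C D x)"
    if "x \<in> cells C" for \<alpha> n x
    using that by (simp add: pushout_bd push_eq.Inl_refl push_class_eqI[OF push_eq.Inl_bd])
  show "push_inl A f g C D (comp C n x y) =
      comp (pushout A f g C D) n (push_inl A f g C D x) (push_inl A f g C D y)"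
    if xy: "composable C n x y" for n x y
  proof -
    have "push_wf A f g C D (Comp n (Inl_gen x) (Inl_gen y))"
      using push_eq_wf[OF C D f g push_eq.Inl_comp[OF xy]] by blast
    then show ?thesis
      by (simp add: pushout_comp push_eq.Inl_refl push_class_eqI[OF push_eq.Inl_comp[OF xy]])
  qed
qed (use C D f g pushout_omega_category in auto)

lemma push_inr_functor:
  assumes C: "strict_omega_category C" and D: "strict_omega_category D"
    and f: "f \<in> cells A \<rightarrow> cells C" and g: "g \<in> cells A \<rightarrow> cells D"
  shows "strict_functor D (pushout A f g C D) (push_inr A f g C D)"
  unfolding strict_functor_def
proof (intro conjI allI ballI impI)
  show "(\<lambda>x. push_inr A f g C D x) \<in> cells D \<rightarrow> cells (pushout A f g C D)"
    by (auto intro: pushout_cellsI push_eq.Inr_refl)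
  show "push_inr A f g C D (bd D \<alpha> n x) = bd (pushout A f g C D) \<alpha> n (push_inr A f g C D x)"
    if "x \<in> cells D" for \<alpha> n x
    using that by (simp add: pushout_bd push_eq.Inr_refl push_class_eqI[OF push_eq.Inr_bd])
  show "push_inr A f g C D (comp D n x y) =
      comp (pushout A f g C D) n (push_inr A f g C D x) (push_inr A f g C D y)"
    if xy: "composable D n x y" for n x y
  proof -
    have "push_wf A f g C D (Comp n (Inr_gen x) (Inr_gen y))"
      using push_eq_wf[OF C D f g push_eq.Inr_comp[OF xy]] by blast
    then show ?thesis
      by (simp add: pushout_comp push_eq.Inr_refl push_class_eqI[OF push_eq.Inr_comp[OF xy]])
  qed
qed (use C D f g pushout_omega_category in auto)

lemma pushout_glue:
  "a \<in> cells A \<Longrightarrow> push_inl A f g C D (f a) = push_inr A f g C D (g a)"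
  by (rule push_class_eqI[OF push_eq.glue])

primrec push_eval where
  "push_eval E u v (Inl_gen x) = u x"
| "push_eval E u v (Inr_gen y) = v y"
| "push_eval E u v (Bd \<alpha> n t) = bd E \<alpha> n (push_eval E u v t)"
| "push_eval E u v (Comp n t s) = comp E n (push_eval E u v t) (push_eval E u v s)"

lemma push_eval_eq:
  assumes u: "strict_functor C E u" and v: "strict_functor D E v"
    and f: "f \<in> cells A \<rightarrow> cells C" and g: "g \<in> cells A \<rightarrow> cells D"
    and uv: "\<And>a. a \<in> cells A \<Longrightarrow> u (f a) = v (g a)"
    and ts: "push_eq A f g C D t s"
  shows "push_eval E u v t \<in> cells E \<and> push_eval E u v s \<in> cells E \<and>
    push_eval E u v t = push_eval E u v s"
proof -
  have E: "strict_omega_category E" using u by (simp add: strict_functor_def)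
  note ax = strict_omega_category.bd_closed[OF E] strict_omega_category.comp_closed[OF E]
    strict_omega_category.bd_bd_less[OF E] strict_omega_category.bd_bd_ge[OF E]
    strict_omega_category.unit_left[OF E] strict_omega_category.unit_right[OF E]
    strict_omega_category.bd_comp_less[OF E] strict_omega_category.source_comp[OF E]
    strict_omega_category.target_comp[OF E] strict_omega_category.bd_comp_greater[OF E]
    strict_omega_category.comp_assoc[OF E]
  have C: "strict_omega_category C" and D: "strict_omega_category D"
    using u v by (simp_all add: strict_functor_def)
  have u': "x \<in> cells C \<Longrightarrow> u x \<in> cells E" "x \<in> cells C \<Longrightarrow> u (bd C \<alpha> n x) = bd E \<alpha> n (u x)"
    "composable C n x y \<Longrightarrow> u (comp C n x y) = comp E n (u x) (u y)"
    "composable C n x y \<Longrightarrow> composable E n (u x) (u y)" for x y n \<alpha>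
    using u by (auto simp: strict_functor_def composable_def) metis
  have v': "x \<in> cells D \<Longrightarrow> v x \<in> cells E" "x \<in> cells D \<Longrightarrow> v (bd D \<alpha> n x) = bd E \<alpha> n (v x)"
    "composable D n x y \<Longrightarrow> v (comp D n x y) = comp E n (v x) (v y)"
    "composable D n x y \<Longrightarrow> composable E n (v x) (v y)" for x y n \<alpha>
    using v by (auto simp: strict_functor_def composable_def) metis
  show ?thesis
    using ts
  proof (induction rule: push_eq.induct)
    case (Comp_cong t t' u u' n)
    then show ?case using ax(2) by (simp add: composable_def)
  next
    case (Inl_comp n x y)
    then show ?case using u'(3,4) ax(2) by simp
  next
    case (Inr_comp n x y)
    then show ?case using v'(3,4) ax(2) by simp
  next
    case (glue a)
    then have "f a \<in> cells C" "g a \<in> cells D" using f g by auto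
    then show ?case using uv[OF glue.hyps] u'(1)[of "f a"] v'(1)[of "g a"] by simp
  next
    case (Unit_left t n)
    then show ?case by (simp add: ax)
  next
    case (Unit_right t n)
    then show ?case by (simp add: ax)
  next
    case (Bd_Comp_less t u n m \<alpha>)
    then show ?case by (simp add: ax composable_def)
  next
    case (Source_Comp t u n)
    then show ?case by (simp add: ax composable_def)
  next
    case (Target_Comp t u n)
    then show ?case by (simp add: ax composable_def)
  next
    case (Bd_Comp_greater t s n m \<alpha>)
    then have c: "composable E n (push_eval E u v t) (push_eval E u v s)"
      by (simp add: composable_def)
    then show ?case using ax(10)[OF c Bd_Comp_greater.hyps(4), of \<alpha>]
        ax(1)[OF ax(2)[OF c], of \<alpha> m] by simp
  next
    case (Assoc t s w n)
    then have c: "composable E n (push_eval E u v t) (push_eval E u v s)"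
      "composable E n (push_eval E u v s) (push_eval E u v w)"
      by (simp_all add: composable_def)
    then have "composable E n (comp E n (push_eval E u v t) (push_eval E u v s)) (push_eval E u v w)"
      by (simp add: composable_def ax)
    then show ?case using ax(11)[OF c] ax(2) by force
  next
    case (Interchange m n t s t' s')
    let ?e = "push_eval E u v"
    have c: "composable E n (?e t) (?e s)" "composable E n (?e t') (?e s')"
      "composable E m (?e t) (?e t')" "composable E m (?e s) (?e s')"
      using Interchange by (simp_all add: composable_def)
    have "composable E m (comp E n (?e t) (?e s)) (comp E n (?e t') (?e s'))"
      using c Interchange.hyps(1)
      by (simp add: composable_def ax)
    then show ?case
      using strict_omega_category.interchange[OF E Interchange.hyps(1) c] ax(2) by force
  qed (simp_all add: ax u' v')
qed

theorem pushout_universal: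
  assumes f: "strict_functor A C f" and g: "strict_functor A D g"
    and u: "strict_functor C E u" and v: "strict_functor D E v"
    and uv: "\<And>a. a \<in> cells A \<Longrightarrow> u (f a) = v (g a)"
  shows "\<exists>h. strict_functor (pushout A f g C D) E h \<and>
    (\<forall>x\<in>cells C. h (push_inl A f g C D x) = u x) \<and>
    (\<forall>y\<in>cells D. h (push_inr A f g C D y) = v y) \<and>
    (\<forall>h'. strict_functor (pushout A f g C D) E h' \<and>
      (\<forall>x\<in>cells C. h' (push_inl A f g C D x) = u x) \<and>
      (\<forall>y\<in>cells D. h' (push_inr A f g C D y) = v y) \<longrightarrow>
      (\<forall>X\<in>cells (pushout A f g C D). h' X = h X))"
proof -
  let ?P = "pushout A f g C D"
  let ?cls = "push_class A f g C D"
  let ?e = "push_eval E u v"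
  have f': "f \<in> cells A \<rightarrow> cells C" and g': "g \<in> cells A \<rightarrow> cells D"
    and C: "strict_omega_category C" and D: "strict_omega_category D" and E: "strict_omega_category E"
    using f g u by (simp_all add: strict_functor_def)
  note ev = push_eval_eq[OF u v f' g' uv]
  define h where "h X = ?e (SOME t. t \<in> X)" for X
  have h: "h (?cls t) = ?e t" if "push_eq A f g C D t t" for t
  proof -
    have "t \<in> ?cls t" using that by (simp add: push_class_def)
    then have "(SOME s. s \<in> ?cls t) \<in> ?cls t" by (rule someI)
    then have "push_eq A f g C D t (SOME s. s \<in> ?cls t)" by (simp add: push_class_def)
    from ev[OF _ this] show ?thesis by (simp add: h_def)
  qed
  have fun_h: "strict_functor ?P E h"
    unfolding strict_functor_def
  proof (intro conjI allI ballI impI)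
    show "h \<in> cells ?P \<rightarrow> cells E"
    proof
      fix X assume "X \<in> cells ?P"
      then obtain t where t: "push_eq A f g C D t t" "X = ?cls t" by (auto simp: pushout_cells)
      then show "h X \<in> cells E" using h ev[OF _ t(1)] by simp
    qed
    show "h (bd ?P \<alpha> n X) = bd E \<alpha> n (h X)" if "X \<in> cells ?P" for \<alpha> n X
    proof -
      obtain t where t: "push_eq A f g C D t t" "X = ?cls t"
        using \<open>X \<in> cells ?P\<close> by (auto simp: pushout_cells)
      then show ?thesis by (simp add: h pushout_bd push_eq.Bd_cong)
    qed
    show "h (comp ?P n X Y) = comp E n (h X) (h Y)" if XY: "composable ?P n X Y" for n X Y
    proof -
      obtain t s where "X = ?cls t" "Y = ?cls s" "push_eq A f g C D t t" "push_eq A f g C D s s"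
        "push_eq A f g C D (Bd Plus n t) (Bd Minus n s)"
        using XY by (rule composable_pushoutE)
      then show ?thesis by (simp add: h pushout_comp push_eq.Comp_cong)
    qed
  qed (use E pushout_omega_category[OF C D f' g'] in auto)
  have uniq: "h' X = h X" if h': "strict_functor ?P E h'"
    and l: "\<forall>x\<in>cells C. h' (push_inl A f g C D x) = u x"
    and r: "\<forall>y\<in>cells D. h' (push_inr A f g C D y) = v y" and X: "X \<in> cells ?P" for h' X
  proof -
    obtain t where t: "push_eq A f g C D t t" "X = ?cls t" using X by (auto simp: pushout_cells)
    have wf: "push_wf A f g C D t" using push_eq_wf[OF C D f' g' t(1)] by blast
    have "h' (?cls t) = ?e t" using wf
    proof (induction t)
      case (Bd \<alpha> n t)
      then have t: "push_eq A f g C D t t" by (simp add: push_wf_refl)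
      then have "h' (bd ?P \<alpha> n (?cls t)) = bd E \<alpha> n (h' (?cls t))"
        using h' pushout_cellsI[OF t] by (simp add: strict_functor_def)
      then show ?case using Bd t by (simp add: pushout_bd)
    next
      case (Comp n t s)
      then have t: "push_eq A f g C D t t" and s: "push_eq A f g C D s s"
        and ts: "push_eq A f g C D (Bd Plus n t) (Bd Minus n s)" by (simp_all add: push_wf_refl)
      have "h' (comp ?P n (?cls t) (?cls s)) = comp E n (h' (?cls t)) (h' (?cls s))"
        using h' pushout_composable[OF t s] ts by (simp add: strict_functor_def)
      then show ?case using Comp t s ts by (simp add: pushout_comp)
    qed (use l r in auto)
    then show ?thesis using h t by simp
  qed
  show ?thesis
  proof (intro exI[of _ h] conjI ballI allI impI)
    show "h (push_inl A f g C D x) = u x" if "x \<in> cells C" for x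
      using that h push_eq.Inl_refl by fastforce
    show "h (push_inr A f g C D y) = v y" if "y \<in> cells D" for y
      using that h push_eq.Inr_refl by fastforce
  qed (use fun_h uniq in auto)
qed

section \<open>Augmented directed complexes with basis\<close>

text \<open>
  Chains are elements of the free abelian group \<open>'b \<Rightarrow>\<^sub>0 int\<close> on the (graded) basis, and
  \<open>frag_extend\<close> is linear extension.  The directed structure is the one generated by the basis:
  the positive chains are those with nonnegative coefficients.
\<close>

record 'b adc =
  basis :: "'b set"
  deg :: "'b \<Rightarrow> nat"
  bdry :: "'b \<Rightarrow> ('b \<Rightarrow>\<^sub>0 int)"
  aug :: "'b \<Rightarrow> int"

definition chain_group :: "'b adc \<Rightarrow> nat \<Rightarrow> ('b \<Rightarrow>\<^sub>0 int) set" where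
  "chain_group K n = {c. Poly_Mapping.keys c \<subseteq> {b \<in> basis K. deg K b = n}}"

definition positive :: "('b \<Rightarrow>\<^sub>0 int) \<Rightarrow> bool" where
  "positive c \<longleftrightarrow> (\<forall>b. 0 \<le> Poly_Mapping.lookup c b)"

definition bdry_chain :: "'b adc \<Rightarrow> ('b \<Rightarrow>\<^sub>0 int) \<Rightarrow> ('b \<Rightarrow>\<^sub>0 int)" where
  "bdry_chain K = frag_extend (bdry K)"

definition aug_chain :: "'b adc \<Rightarrow> ('b \<Rightarrow>\<^sub>0 int) \<Rightarrow> int" where
  "aug_chain K c = (\<Sum>b\<in>Poly_Mapping.keys c. Poly_Mapping.lookup c b * aug K b)"

definition map_chain :: "('a \<Rightarrow> 'b) \<Rightarrow> ('a \<Rightarrow>\<^sub>0 int) \<Rightarrow> ('b \<Rightarrow>\<^sub>0 int)" where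
  "map_chain \<phi> = frag_extend (\<lambda>b. frag_of (\<phi> b))"

locale augmented_directed_complex =
  fixes K :: "'b adc"
  assumes bdry_chains: "b \<in> basis K \<Longrightarrow> c \<in> Poly_Mapping.keys (bdry K b) \<Longrightarrow>
      c \<in> basis K \<and> deg K b = Suc (deg K c)"
    and bdry_bdry: "b \<in> basis K \<Longrightarrow> bdry_chain K (bdry K b) = 0"
    and aug_bdry: "b \<in> basis K \<Longrightarrow> aug_chain K (bdry K b) = 0"
    and aug_pos_deg: "b \<in> basis K \<Longrightarrow> 0 < deg K b \<Longrightarrow> aug K b = 0"

text \<open>
  The omega-category \<open>\<nu>(K)\<close>: its cells are the double sequences of positive chains
  \<open>x i Minus, x i Plus\<close> of degree \<open>i\<close>, almost all zero, with \<open>aug (x 0 \<alpha>) = 1\<close> and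
  \<open>d (x (i+1) \<alpha>) = x i Plus - x i Minus\<close>.
\<close>

definition nu_bd :: "polarity \<Rightarrow> nat \<Rightarrow> (nat \<Rightarrow> polarity \<Rightarrow> 'b \<Rightarrow>\<^sub>0 int) \<Rightarrow>
    nat \<Rightarrow> polarity \<Rightarrow> 'b \<Rightarrow>\<^sub>0 int" where
  "nu_bd \<alpha> n x = (\<lambda>i \<beta>. if i < n then x i \<beta> else if i = n then x n \<alpha> else 0)"

definition nu :: "'b adc \<Rightarrow> (nat \<Rightarrow> polarity \<Rightarrow> 'b \<Rightarrow>\<^sub>0 int) ocat" where
  "nu K =
    \<lparr>cells = {x. (\<forall>i \<alpha>. x i \<alpha> \<in> chain_group K i \<and> positive (x i \<alpha>)) \<and>
                (\<exists>N. \<forall>i\<ge>N. \<forall>\<alpha>. x i \<alpha> = 0) \<and>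
                (\<forall>\<alpha>. aug_chain K (x 0 \<alpha>) = 1) \<and>
                (\<forall>i \<alpha>. bdry_chain K (x (Suc i) \<alpha>) = x i Plus - x i Minus)},
     bd = nu_bd,
     comp = (\<lambda>n x y i \<beta>. x i \<beta> - nu_bd Plus n x i \<beta> + y i \<beta>)\<rparr>"

definition nu_vertex :: "'b \<Rightarrow> nat \<Rightarrow> polarity \<Rightarrow> 'b \<Rightarrow>\<^sub>0 int" where
  "nu_vertex b = (\<lambda>i \<alpha>. if i = 0 then frag_of b else 0)"

definition nu_map :: "('a \<Rightarrow> 'b) \<Rightarrow> (nat \<Rightarrow> polarity \<Rightarrow> 'a \<Rightarrow>\<^sub>0 int) \<Rightarrow>
    nat \<Rightarrow> polarity \<Rightarrow> 'b \<Rightarrow>\<^sub>0 int" where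
  "nu_map \<phi> x = (\<lambda>i \<alpha>. map_chain \<phi> (x i \<alpha>))"

definition tensor :: "'a adc \<Rightarrow> 'b adc \<Rightarrow> ('a \<times> 'b) adc" where
  "tensor K L =
    \<lparr>basis = basis K \<times> basis L,
     deg = (\<lambda>(a, b). deg K a + deg L b),
     bdry = (\<lambda>(a, b). map_chain (\<lambda>a'. (a', b)) (bdry K a) +
                      frag_cmul ((-1) ^ deg K a) (map_chain (\<lambda>b'. (a, b')) (bdry L b))),
     aug = (\<lambda>(a, b). aug K a * aug L b)\<rparr>"

text \<open>Transport of structure along an injection of basis elements.\<close>

definition relabel :: "('a \<Rightarrow> 'b) \<Rightarrow> 'a adc \<Rightarrow> 'b adc" where
  "relabel \<phi> K =
    \<lparr>basis = \<phi> ` basis K, deg = (\<lambda>b. deg K (inv \<phi> b)),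
     bdry = (\<lambda>b. map_chain \<phi> (bdry K (inv \<phi> b))), aug = (\<lambda>b. aug K (inv \<phi> b))\<rparr>"

text \<open>
  The tensor power \<open>K \<otimes> (K \<otimes> (\<dots> \<otimes> unit))\<close>, with the basis element
  \<open>(a1, (a2, \<dots>))\<close> written as the list \<open>[a1, a2, \<dots>]\<close> so that all powers live in one type.
\<close>

definition unit_complex :: "'a list adc" where
  "unit_complex = \<lparr>basis = {[]}, deg = (\<lambda>_. 0), bdry = (\<lambda>_. 0), aug = (\<lambda>_. 1)\<rparr>"

primrec tensor_power :: "'a adc \<Rightarrow> nat \<Rightarrow> 'a list adc" where
  "tensor_power K 0 = unit_complex"
| "tensor_power K (Suc n) = relabel (\<lambda>(a, as). a # as) (tensor K (tensor_power K n))"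


section \<open>Cubes, their Gray tensor products, and wedge sums\<close>

text \<open>The complex of the arrow category: two vertices and an edge from \<open>V0\<close> to \<open>V1\<close>.\<close>

datatype interval = V0 | V1 | E01

definition arrow_complex :: "interval adc" where
  "arrow_complex =
    \<lparr>basis = UNIV,
     deg = (\<lambda>e. if e = E01 then 1 else 0),
     bdry = (\<lambda>e. if e = E01 then frag_of V1 - frag_of V0 else 0),
     aug = (\<lambda>e. if e = E01 then 0 else 1)\<rparr>"

definition cube_complex :: "nat \<Rightarrow> interval list adc" where
  "cube_complex n = tensor_power arrow_complex n"

definition cube :: "nat \<Rightarrow> (nat \<Rightarrow> polarity \<Rightarrow> interval list \<Rightarrow>\<^sub>0 int) bipointed_ocat" where
  "cube n = bipoint (nu (cube_complex n))
     (nu_vertex (replicate n V0)) (nu_vertex (replicate n V1))"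

text \<open>
  The lax Gray tensor product of \<open>\<nu>(K)\<close> and \<open>\<nu>(L)\<close>, for \<open>K\<close> and \<open>L\<close> with strongly loop-free
  unital bases (as the complexes of cubes are).
\<close>

definition gray :: "'a adc \<Rightarrow> 'b adc \<Rightarrow> (nat \<Rightarrow> polarity \<Rightarrow> 'a \<times> 'b \<Rightarrow>\<^sub>0 int) ocat" where
  "gray K L = nu (tensor K L)"

definition gray_cubes ::
    "nat \<Rightarrow> nat \<Rightarrow> (nat \<Rightarrow> polarity \<Rightarrow> interval list \<times> interval list \<Rightarrow>\<^sub>0 int) bipointed_ocat" where
  "gray_cubes m n = bipoint (gray (cube_complex m) (cube_complex n))
     (nu_vertex (replicate m V0, replicate n V0)) (nu_vertex (replicate m V1, replicate n V1))"

text \<open>The wedge sum is the pushout along the points \<open>\<lambda>_. second_pt C\<close> and \<open>\<lambda>_. first_pt D\<close>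
  of the terminal omega-category \<open>cube 0\<close>.\<close>

definition wedge :: "('a, 'm) bipointed_ocat_scheme \<Rightarrow> ('b, 'k) bipointed_ocat_scheme \<Rightarrow>
    ('a, 'b) expr set bipointed_ocat" where
  "wedge C D =
    (let A = cube 0; f = (\<lambda>_. second_pt C); g = (\<lambda>_. first_pt D)
     in bipoint (pushout A f g C D)
          (push_inl A f g C D (first_pt C)) (push_inr A f g C D (second_pt D)))"


section \<open>Basic facts\<close>

lemma map_chain_simps [simp]:
  "map_chain \<phi> 0 = 0" "map_chain \<phi> (frag_of b) = frag_of (\<phi> b)"
  "map_chain \<phi> (x + y) = map_chain \<phi> x + map_chain \<phi> y"
  "map_chain \<phi> (x - y) = map_chain \<phi> x - map_chain \<phi> y"
  "map_chain \<phi> (frag_cmul k x) = frag_cmul k (map_chain \<phi> x)"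
  by (simp_all add: map_chain_def frag_extend_add frag_extend_diff frag_extend_cmul)

lemma bdry_chain_simps [simp]:
  "bdry_chain K 0 = 0" "bdry_chain K (frag_of b) = bdry K b"
  "bdry_chain K (x + y) = bdry_chain K x + bdry_chain K y"
  "bdry_chain K (x - y) = bdry_chain K x - bdry_chain K y"
  "bdry_chain K (frag_cmul k x) = frag_cmul k (bdry_chain K x)"
  by (simp_all add: bdry_chain_def frag_extend_add frag_extend_diff frag_extend_cmul)

lemma map_chain_compose: "map_chain \<phi> (map_chain \<psi> c) = map_chain (\<lambda>b. \<phi> (\<psi> b)) c"
  using frag_extend_compose[of "\<lambda>b. frag_of (\<phi> b)" \<psi> c] by (simp add: map_chain_def o_def)

lemma map_chain_cong:
  "(\<And>b. b \<in> Poly_Mapping.keys c \<Longrightarrow> \<phi> b = \<psi> b) \<Longrightarrow> map_chain \<phi> c = map_chain \<psi> c"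
  unfolding map_chain_def by (rule frag_extend_eq) simp

lemma map_chain_ident: "map_chain (\<lambda>b. b) c = c"
  unfolding map_chain_def using frag_expansion[of c] by simp

lemma keys_map_chain: "Poly_Mapping.keys (map_chain \<phi> c) \<subseteq> \<phi> ` Poly_Mapping.keys c"
  using keys_frag_extend[of "\<lambda>b. frag_of (\<phi> b)" c] by (auto simp: map_chain_def keys_frag_of)

lemma aug_chain_superset:
  assumes "finite S" "Poly_Mapping.keys c \<subseteq> S"
  shows "aug_chain K c = (\<Sum>b\<in>S. Poly_Mapping.lookup c b * aug K b)"
  unfolding aug_chain_def
  by (rule sum.mono_neutral_left[OF assms]) (simp add: in_keys_iff)

lemma aug_chain_simps [simp]:
  "aug_chain K 0 = 0" "aug_chain K (frag_of b) = aug K b"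
  "aug_chain K (x + y) = aug_chain K x + aug_chain K y"
  "aug_chain K (x - y) = aug_chain K x - aug_chain K y"
  "aug_chain K (frag_cmul k x) = k * aug_chain K x"
proof -
  let ?S = "Poly_Mapping.keys x \<union> Poly_Mapping.keys y"
  have S: "finite ?S" by simp
  note e = aug_chain_superset[OF S, of _ K]
  show "aug_chain K (x + y) = aug_chain K x + aug_chain K y"
    using e[of "x + y"] e[of x] e[of y] keys_add[of x y]
    by (simp add: lookup_add distrib_right sum.distrib)
  show "aug_chain K (x - y) = aug_chain K x - aug_chain K y"
    using e[of "x - y"] e[of x] e[of y] keys_diff[of x y]
    by (simp add: lookup_minus left_diff_distrib sum_subtractf)
  show "aug_chain K (frag_cmul k x) = k * aug_chain K x"
    using e[of "frag_cmul k x"] e[of x] keys_cmul[of k x]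
    by (simp add: sum_distrib_left mult.assoc le_supI1)
qed (simp_all add: aug_chain_def)

lemma aug_chain_map:
  assumes "\<And>b. b \<in> Poly_Mapping.keys c \<Longrightarrow> aug L (\<phi> b) = k * aug K b"
  shows "aug_chain L (map_chain \<phi> c) = k * aug_chain K c"
proof -
  have "Poly_Mapping.keys c \<subseteq> {b. aug L (\<phi> b) = k * aug K b}" using assms by blast
  then show ?thesis
    by (induction c rule: frag_induction) (simp_all add: right_diff_distrib)
qed

lemma chain_group_simps:
  "0 \<in> chain_group K n"
  "frag_of b \<in> chain_group K n \<longleftrightarrow> b \<in> basis K \<and> deg K b = n"
  "x \<in> chain_group K n \<Longrightarrow> y \<in> chain_group K n \<Longrightarrow> x + y \<in> chain_group K n"
  "x \<in> chain_group K n \<Longrightarrow> y \<in> chain_group K n \<Longrightarrow> x - y \<in> chain_group K n"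
  using keys_add[of x y] keys_diff[of x y] by (auto simp: chain_group_def keys_frag_of)

lemma positive_simps:
  "positive 0" "positive (frag_of b)" "positive x \<Longrightarrow> positive y \<Longrightarrow> positive (x + y)"
  by (auto simp: positive_def lookup_add)

lemma positive_map_chain: assumes "positive c" shows "positive (map_chain \<phi> c)"
  using assms unfolding positive_def map_chain_def frag_extend_def
  by (auto simp: lookup_sum intro!: sum_nonneg)

lemma nu_cells:
  "x \<in> cells (nu K) \<longleftrightarrow> (\<forall>i \<alpha>. x i \<alpha> \<in> chain_group K i \<and> positive (x i \<alpha>)) \<and>
    (\<exists>N. \<forall>i\<ge>N. \<forall>\<alpha>. x i \<alpha> = 0) \<and> (\<forall>\<alpha>. aug_chain K (x 0 \<alpha>) = 1) \<and>
    (\<forall>i \<alpha>. bdry_chain K (x (Suc i) \<alpha>) = x i Plus - x i Minus)"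
  by (simp add: nu_def)

lemma bd_nu [simp]: "bd (nu K) = nu_bd" by (simp add: nu_def)

lemma comp_nu [simp]: "comp (nu K) n x y = (\<lambda>i \<beta>. x i \<beta> - nu_bd Plus n x i \<beta> + y i \<beta>)"
  by (simp add: nu_def)

lemma nu_composableD:
  assumes "composable (nu K) n x y"
  shows "x \<in> cells (nu K)" "y \<in> cells (nu K)" "x n Plus = y n Minus" "i < n \<Longrightarrow> x i \<beta> = y i \<beta>"
proof -
  have eq: "nu_bd Plus n x = nu_bd Minus n y" and "x \<in> cells (nu K)" "y \<in> cells (nu K)"
    using assms by (simp_all add: composable_def)
  then show "x \<in> cells (nu K)" "y \<in> cells (nu K)" by simp_all
  show "x n Plus = y n Minus" using fun_cong[OF fun_cong[OF eq], of n Plus] by (simp add: nu_bd_def)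
  show "i < n \<Longrightarrow> x i \<beta> = y i \<beta>"
    using fun_cong[OF fun_cong[OF eq], of i \<beta>] by (simp add: nu_bd_def)
qed

lemma nu_comp_eq:
  assumes "composable (nu K) n x y"
  shows "comp (nu K) n x y = (\<lambda>i \<beta>. if i < n then x i \<beta>
    else if i = n then (case \<beta> of Minus \<Rightarrow> x n Minus | Plus \<Rightarrow> y n Plus) else x i \<beta> + y i \<beta>)"
  using nu_composableD[OF assms] by (auto simp: nu_bd_def fun_eq_iff split: polarity.split)

lemma nu_omega_category: "strict_omega_category (nu K)"
proof
  fix x assume x: "x \<in> cells (nu K)"
  have "\<exists>N. \<forall>i\<ge>N. \<forall>\<alpha>. x i \<alpha> = 0" using x by (simp add: nu_cells)
  then obtain N where N: "\<And>i \<alpha>. i \<ge> N \<Longrightarrow> x i \<alpha> = 0" by blast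
  show "bd (nu K) \<alpha> n x \<in> cells (nu K)" for \<alpha> n
  proof -
    have "\<forall>i\<ge>N. \<forall>\<beta>. nu_bd \<alpha> n x i \<beta> = 0" using N by (auto simp: nu_bd_def)
    then have "\<exists>N. \<forall>i\<ge>N. \<forall>\<beta>. nu_bd \<alpha> n x i \<beta> = 0" by blast
    moreover have "nu_bd \<alpha> n x i \<beta> \<in> chain_group K i \<and> positive (nu_bd \<alpha> n x i \<beta>)" for i \<beta>
      using x by (auto simp: nu_cells nu_bd_def chain_group_simps positive_simps)
    moreover have "aug_chain K (nu_bd \<alpha> n x 0 \<beta>) = 1" for \<beta>
      using x by (auto simp: nu_cells nu_bd_def)
    moreover have "bdry_chain K (nu_bd \<alpha> n x (Suc i) \<beta>) = nu_bd \<alpha> n x i Plus - nu_bd \<alpha> n x i Minus"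
      for i \<beta>
    proof -
      consider "Suc i < n" | "n = Suc i" | "i = n" | "n < i" by linarith
      then show ?thesis using x by cases (auto simp: nu_cells nu_bd_def)
    qed
    ultimately show ?thesis by (simp add: nu_cells)
  qed
  show "bd (nu K) \<beta> m (bd (nu K) \<alpha> n x) = bd (nu K) \<beta> m x" if "m < n" for \<alpha> \<beta> m n
    using that by (auto simp: nu_bd_def fun_eq_iff)
  show "bd (nu K) \<beta> m (bd (nu K) \<alpha> n x) = bd (nu K) \<alpha> n x" if "n \<le> m" for \<alpha> \<beta> m n
    using that by (auto simp: nu_bd_def fun_eq_iff)
  have "bd (nu K) \<alpha> N x = x" for \<alpha> using N by (auto simp: nu_bd_def fun_eq_iff)
  then show "\<exists>n. \<forall>\<alpha>. bd (nu K) \<alpha> n x = x" by blast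
  show "comp (nu K) n (bd (nu K) Minus n x) x = x" for n
    by (auto simp: nu_bd_def fun_eq_iff)
  show "comp (nu K) n x (bd (nu K) Plus n x) = x" for n
    by (auto simp: nu_bd_def fun_eq_iff)
next
  fix n x y assume xy: "composable (nu K) n x y"
  note D = nu_composableD[OF xy]
  note x = D(1)[unfolded nu_cells] and y = D(2)[unfolded nu_cells]
  note c = nu_comp_eq[OF xy]
  show "comp (nu K) n x y \<in> cells (nu K)"
    unfolding nu_cells
  proof (intro conjI allI)
    fix i \<alpha>
    show "comp (nu K) n x y i \<alpha> \<in> chain_group K i" "positive (comp (nu K) n x y i \<alpha>)"
      unfolding c using x y by (auto simp: chain_group_simps positive_simps split: polarity.split)
    show "aug_chain K (comp (nu K) n x y 0 \<alpha>) = 1"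
      unfolding c using x y by (cases "n = 0") (auto split: polarity.split)
    show "bdry_chain K (comp (nu K) n x y (Suc i) \<alpha>) =
      comp (nu K) n x y i Plus - comp (nu K) n x y i Minus"
    proof -
      consider "Suc i < n" | "n = Suc i" | "i = n" | "n < i" by linarith
      then show ?thesis
        unfolding c using x y D(3) D(4)[of i]
        by cases (auto split: polarity.split)
    qed
  next
    obtain N where N: "\<And>i \<alpha>. i \<ge> N \<Longrightarrow> x i \<alpha> = 0" using x by blast
    obtain M where M: "\<And>i \<alpha>. i \<ge> M \<Longrightarrow> y i \<alpha> = 0" using y by blast
    show "\<exists>N. \<forall>i\<ge>N. \<forall>\<alpha>. comp (nu K) n x y i \<alpha> = 0"
      unfolding c by (rule exI[of _ "N + M"]) (auto simp: N M split: polarity.split)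
  qed
  show "bd (nu K) \<alpha> m (comp (nu K) n x y) = bd (nu K) \<alpha> m x" if "m < n" for \<alpha> m
    unfolding c using that by (auto simp: nu_bd_def fun_eq_iff)
  show "bd (nu K) Minus n (comp (nu K) n x y) = bd (nu K) Minus n x"
    unfolding c by (auto simp: nu_bd_def fun_eq_iff)
  show "bd (nu K) Plus n (comp (nu K) n x y) = bd (nu K) Plus n y"
    unfolding c using D(4) by (auto simp: nu_bd_def fun_eq_iff)
  show "bd (nu K) \<alpha> m (comp (nu K) n x y) = comp (nu K) n (bd (nu K) \<alpha> m x) (bd (nu K) \<alpha> m y)"
    if "n < m" for \<alpha> m
    using that by (auto simp: nu_bd_def fun_eq_iff)
  show "comp (nu K) n (comp (nu K) n x y) z = comp (nu K) n x (comp (nu K) n y z)"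
    if "composable (nu K) n y z" for z
    using D(3,4) by (auto simp: nu_bd_def fun_eq_iff)
  show "comp (nu K) m (comp (nu K) n x y) (comp (nu K) n x' y') =
      comp (nu K) n (comp (nu K) m x x') (comp (nu K) m y y')"
    if "m < n" "composable (nu K) n x' y'" "composable (nu K) m x x'" "composable (nu K) m y y'"
    for m x' y'
    using that(1) D(3,4) nu_composableD(3,4)[OF that(2)] nu_composableD(3,4)[OF that(3)]
      nu_composableD(3,4)[OF that(4)]
    by (auto simp: nu_bd_def fun_eq_iff)
qed

lemma nu_vertex_object:
  assumes "augmented_directed_complex K" "b \<in> basis K" "deg K b = 0" "aug K b = 1"
  shows "is_object (nu K) (nu_vertex b)"
proof -
  have "Poly_Mapping.keys (bdry K b) = {}"
    using augmented_directed_complex.bdry_chains[OF assms(1,2)] assms(3) by force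
  then show ?thesis
    using assms
    by (auto simp: is_object_def nu_cells nu_vertex_def nu_bd_def chain_group_simps positive_simps
        fun_eq_iff intro!: exI[of _ "Suc 0"])
qed

lemma frag_cmul_sub: "frag_cmul k (x - y) = frag_cmul k x - frag_cmul k y"
  by (rule poly_mapping_eqI) (simp add: lookup_minus right_diff_distrib)

lemma frag_extend_fun_diff:
  "frag_extend (\<lambda>b. f b - g b) c = frag_extend f c - frag_extend g c"
  using subset_UNIV[of "Poly_Mapping.keys c"] by (induction c rule: frag_induction) (simp_all add: frag_extend_diff)

lemma map_chain_swap:
  "frag_extend (\<lambda>a. map_chain (\<lambda>b. (a, b)) d) c = frag_extend (\<lambda>b. map_chain (\<lambda>a. (a, b)) c) d"
  using subset_UNIV[of "Poly_Mapping.keys c"]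
proof (induction c rule: frag_induction)
  case zero
  show ?case by (simp add: frag_extend_eq_0)
next
  case (one a)
  show ?case by (simp add: map_chain_def)
next
  case (diff c c')
  then show ?case by (simp add: frag_extend_diff frag_extend_fun_diff)
qed

lemma bdry_tensor_left:
  assumes "Poly_Mapping.keys c \<subseteq> {a. deg K a = p}"
  shows "bdry_chain (tensor K L) (map_chain (\<lambda>a. (a, b)) c) =
    map_chain (\<lambda>a. (a, b)) (bdry_chain K c) +
    frag_cmul ((-1) ^ p) (frag_extend (\<lambda>a. map_chain (\<lambda>b'. (a, b')) (bdry L b)) c)"
  using assms
  by (induction c rule: frag_induction)
    (simp_all add: tensor_def frag_extend_diff algebra_simps
      frag_cmul_sub)

lemma bdry_tensor_right:
  "bdry_chain (tensor K L) (map_chain (\<lambda>b. (a, b)) c) =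
    frag_extend (\<lambda>b. map_chain (\<lambda>a'. (a', b)) (bdry K a)) c +
    frag_cmul ((-1) ^ deg K a) (map_chain (\<lambda>b. (a, b)) (bdry_chain L c))"
  using subset_UNIV[of "Poly_Mapping.keys c"] by (induction c rule: frag_induction)
    (simp_all add: tensor_def frag_extend_diff algebra_simps frag_cmul_sub)

lemma tensor_simps [simp]:
  "basis (tensor K L) = basis K \<times> basis L"
  "deg (tensor K L) (a, b) = deg K a + deg L b"
  "bdry (tensor K L) (a, b) = map_chain (\<lambda>a'. (a', b)) (bdry K a) +
     frag_cmul ((-1) ^ deg K a) (map_chain (\<lambda>b'. (a, b')) (bdry L b))"
  "aug (tensor K L) (a, b) = aug K a * aug L b"
  by (simp_all add: tensor_def)

lemma tensor_adc:
  assumes "augmented_directed_complex K" "augmented_directed_complex L"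
  shows "augmented_directed_complex (tensor K L)"
proof -
  interpret K: augmented_directed_complex K by fact
  interpret L: augmented_directed_complex L by fact
  show ?thesis
  proof
    fix x assume "x \<in> basis (tensor K L)"
    then obtain a b where x: "x = (a, b)" and a: "a \<in> basis K" and b: "b \<in> basis L" by auto
    show "c \<in> basis (tensor K L) \<and> deg (tensor K L) x = Suc (deg (tensor K L) c)"
      if "c \<in> Poly_Mapping.keys (bdry (tensor K L) x)" for c
    proof -
      have "c \<in> Poly_Mapping.keys (map_chain (\<lambda>a'. (a', b)) (bdry K a)) \<union>
          Poly_Mapping.keys (map_chain (\<lambda>b'. (a, b')) (bdry L b))"
        using subsetD[OF keys_add that[unfolded x tensor_simps]] by auto
      then have "c \<in> (\<lambda>a'. (a', b)) ` Poly_Mapping.keys (bdry K a) \<union>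
          (\<lambda>b'. (a, b')) ` Poly_Mapping.keys (bdry L b)"
        using keys_map_chain[of "\<lambda>a'. (a', b)" "bdry K a"]
          keys_map_chain[of "Pair a" "bdry L b"] by auto
      then show ?thesis using x a b K.bdry_chains[OF a] L.bdry_chains[OF b] by auto
    qed
    show "aug (tensor K L) x = 0" if "0 < deg (tensor K L) x"
      using that x a b K.aug_pos_deg L.aug_pos_deg by auto
    have "aug_chain (tensor K L) (map_chain (\<lambda>a'. (a', b)) (bdry K a)) =
        aug L b * aug_chain K (bdry K a)"
      by (rule aug_chain_map) simp
    moreover have "aug_chain (tensor K L) (map_chain (\<lambda>b'. (a, b')) (bdry L b)) =
        aug K a * aug_chain L (bdry L b)"
      by (rule aug_chain_map) simp
    ultimately show "aug_chain (tensor K L) (bdry (tensor K L) x) = 0"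
      using x K.aug_bdry[OF a] L.aug_bdry[OF b] by simp
    show "bdry_chain (tensor K L) (bdry (tensor K L) x) = 0"
    proof (cases "deg K a")
      case 0
      then have "Poly_Mapping.keys (bdry K a) = {}" using K.bdry_chains[OF a] by force
      then have "bdry K a = 0" by simp
      then show ?thesis
        using x L.bdry_bdry[OF b] by (simp add: bdry_tensor_right frag_extend_eq_0)
    next
      case (Suc p)
      have keys: "Poly_Mapping.keys (bdry K a) \<subseteq> {a. deg K a = p}"
        using K.bdry_chains[OF a] Suc by auto
      show ?thesis
        using x K.bdry_bdry[OF a] L.bdry_bdry[OF b]
        by (simp add: bdry_tensor_right bdry_tensor_left[OF keys] Suc map_chain_swap)
          (simp flip: map_chain_swap minus_frag_cmul)
    qed
  qed
qed

lemma relabel_simps: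
  assumes "inj \<phi>"
  shows "basis (relabel \<phi> K) = \<phi> ` basis K" "deg (relabel \<phi> K) (\<phi> b) = deg K b"
    "bdry (relabel \<phi> K) (\<phi> b) = map_chain \<phi> (bdry K b)" "aug (relabel \<phi> K) (\<phi> b) = aug K b"
  using assms by (simp_all add: relabel_def)

lemma bdry_chain_map_chain:
  assumes "\<And>b. b \<in> Poly_Mapping.keys c \<Longrightarrow> bdry L (\<phi> b) = map_chain \<phi> (bdry K b)"
  shows "bdry_chain L (map_chain \<phi> c) = map_chain \<phi> (bdry_chain K c)"
proof -
  have "Poly_Mapping.keys c \<subseteq> {b. bdry L (\<phi> b) = map_chain \<phi> (bdry K b)}" using assms by blast
  then show ?thesis by (induction c rule: frag_induction) simp_all
qed

lemma relabel_adc: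
  assumes "augmented_directed_complex K" and inj: "inj \<phi>"
  shows "augmented_directed_complex (relabel \<phi> K)"
proof -
  interpret K: augmented_directed_complex K by fact
  note [simp] = relabel_simps[OF inj]
  show ?thesis
  proof
    fix x assume "x \<in> basis (relabel \<phi> K)"
    then obtain b where x: "x = \<phi> b" and b: "b \<in> basis K" by auto
    show "c \<in> basis (relabel \<phi> K) \<and> deg (relabel \<phi> K) x = Suc (deg (relabel \<phi> K) c)"
      if "c \<in> Poly_Mapping.keys (bdry (relabel \<phi> K) x)" for c
      using that x keys_map_chain[of \<phi> "bdry K b"] K.bdry_chains[OF b] by auto
    show "aug (relabel \<phi> K) x = 0" if "0 < deg (relabel \<phi> K) x"
      using that x b K.aug_pos_deg by simp
    have "aug_chain (relabel \<phi> K) (map_chain \<phi> (bdry K b)) = 1 * aug_chain K (bdry K b)"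
      by (rule aug_chain_map) simp
    then show "aug_chain (relabel \<phi> K) (bdry (relabel \<phi> K) x) = 0"
      using x K.aug_bdry[OF b] by simp
    show "bdry_chain (relabel \<phi> K) (bdry (relabel \<phi> K) x) = 0"
      using x K.bdry_bdry[OF b] bdry_chain_map_chain[of _ "relabel \<phi> K" \<phi> K] by simp
  qed
qed

lemma inj_cons: "inj (\<lambda>(a, as). a # as)"
  by (auto simp: inj_def)

lemma tensor_power_adc:
  assumes "augmented_directed_complex K"
  shows "augmented_directed_complex (tensor_power K n)"
proof (induction n)
  case 0
  show ?case by unfold_locales (simp_all add: unit_complex_def)
next
  case (Suc n)
  then show ?case by (simp add: relabel_adc tensor_adc assms inj_cons)
qed

lemma tensor_power_Suc_simps:
  "basis (tensor_power K (Suc n)) = {a # as | a as. a \<in> basis K \<and> as \<in> basis (tensor_power K n)}"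
  "deg (tensor_power K (Suc n)) (a # as) = deg K a + deg (tensor_power K n) as"
  "bdry (tensor_power K (Suc n)) (a # as) = map_chain (\<lambda>a'. a' # as) (bdry K a) +
     frag_cmul ((-1) ^ deg K a) (map_chain (\<lambda>as'. a # as') (bdry (tensor_power K n) as))"
  "aug (tensor_power K (Suc n)) (a # as) = aug K a * aug (tensor_power K n) as"
  using relabel_simps[OF inj_cons, of "tensor K (tensor_power K n)"]
    relabel_simps(2-4)[OF inj_cons, of "tensor K (tensor_power K n)" "(a, as)"]
  by (auto simp: map_chain_compose simp del: tensor_power.simps(1) simp: tensor_power.simps(2))

lemma arrow_complex_adc: "augmented_directed_complex arrow_complex"
  by unfold_locales
    (auto simp: arrow_complex_def in_keys_iff lookup_minus split: if_splits)

lemma cube_complex_adc: "augmented_directed_complex (cube_complex n)"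
  by (simp add: cube_complex_def tensor_power_adc arrow_complex_adc)

lemma cube_complex_vertex:
  assumes "v \<noteq> E01"
  shows "replicate n v \<in> basis (cube_complex n)" "deg (cube_complex n) (replicate n v) = 0"
    "aug (cube_complex n) (replicate n v) = 1"
  using assms unfolding cube_complex_def
  by (induction n)
    (simp_all add: tensor_power_Suc_simps del: tensor_power.simps(2), simp_all add: unit_complex_def arrow_complex_def)

lemma bipoint_simps [simp]:
  "cells (bipoint C p q) = cells C" "bd (bipoint C p q) = bd C" "comp (bipoint C p q) = comp C"
  "first_pt (bipoint C p q) = p" "second_pt (bipoint C p q) = q"
  by (simp_all add: bipoint_def ocat.extend_def)

lemma composable_bipoint [simp]: "composable (bipoint C p q) = composable C"
  by (simp add: composable_def fun_eq_iff)

lemma is_object_bipoint [simp]: "is_object (bipoint C p q) = is_object C"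
  by (simp add: is_object_def fun_eq_iff)

lemma strict_omega_category_bipoint [simp]:
  "strict_omega_category (bipoint C p q) \<longleftrightarrow> strict_omega_category C"
  by (simp add: strict_omega_category_def)

lemma bipointed_cube: "bipointed (cube n)"
  by (simp add: bipointed_def cube_def nu_omega_category nu_vertex_object cube_complex_adc
      cube_complex_vertex)

lemma bipointed_gray_cubes: "bipointed (gray_cubes m n)"
  by (simp add: bipointed_def gray_cubes_def gray_def nu_omega_category nu_vertex_object
      cube_complex_adc tensor_adc cube_complex_vertex)

lemma point_functor:
  assumes "strict_omega_category A" "strict_omega_category C" "is_object C p"
  shows "strict_functor A C (\<lambda>_. p)"
proof -
  interpret strict_omega_category C by fact
  have bd: "bd C \<alpha> n p = p" for \<alpha> n
    using bd_bd_ge[of p 0 n \<alpha> Minus] assms(3) by (simp add: is_object_def)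
  have "comp C n p p = p" for n
    using unit_left[of p n] bd assms(3) by (simp add: is_object_def)
  then show ?thesis using assms bd by (auto simp: strict_functor_def is_object_def)
qed

lemma wedge_simps:
  fixes C :: "('a, 'm) bipointed_ocat_scheme" and D :: "('b, 'k) bipointed_ocat_scheme"
  defines "f \<equiv> (\<lambda>_. second_pt C)" and "g \<equiv> (\<lambda>_. first_pt D)"
  shows "wedge C D = bipoint (pushout (cube 0) f g C D)
    (push_inl (cube 0) f g C D (first_pt C)) (push_inr (cube 0) f g C D (second_pt D))"
  by (simp add: wedge_def Let_def f_def g_def)

lemma functor_object:
  assumes "strict_functor C D F" "is_object C p" shows "is_object D (F p)"
  using assms unfolding strict_functor_def is_object_def by (metis PiE)

lemma bipointed_wedge:
  assumes "bipointed C" "bipointed D" shows "bipointed (wedge C D)"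
proof -
  let ?f = "\<lambda>_. second_pt C" and ?g = "\<lambda>_. first_pt D"
  have C: "strict_omega_category C" and D: "strict_omega_category D"
    and f: "?f \<in> cells (cube 0) \<rightarrow> cells C" and g: "?g \<in> cells (cube 0) \<rightarrow> cells D"
    using assms by (auto simp: bipointed_def is_object_def)
  show ?thesis
    using assms pushout_omega_category[OF C D f g]
      functor_object[OF push_inl_functor[OF C D f g]] functor_object[OF push_inr_functor[OF C D f g]]
    by (simp add: wedge_simps bipointed_def)
qed

text \<open>The omega-category \<open>cube 0\<close> along which \<open>wedge\<close> glues is terminal.\<close>

lemma cells_cube_0: "cells (cube 0) = {nu_vertex []}"
proof -
  have "x = nu_vertex []" if x: "x \<in> cells (nu (cube_complex 0))" for x
  proof (intro ext)
    fix i \<alpha>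
    have keys: "Poly_Mapping.keys (x i \<alpha>) \<subseteq> {b. b = [] \<and> i = 0}"
      and aug: "aug_chain (cube_complex 0) (x 0 \<alpha>) = 1"
      using x by (auto simp: nu_cells chain_group_def cube_complex_def unit_complex_def)
    show "x i \<alpha> = nu_vertex [] i \<alpha>"
    proof (cases "i = 0")
      case True
      have "Poly_Mapping.lookup (x 0 \<alpha>) [] = 1"
        using aug aug_chain_superset[of "{[]}" "x 0 \<alpha>" "cube_complex 0"] keys True
        by (auto simp: cube_complex_def unit_complex_def)
      then show ?thesis
        using keys True
        by (intro poly_mapping_eqI) (auto simp: nu_vertex_def in_keys_iff subset_iff)
    next
      case False
      then have "Poly_Mapping.keys (x i \<alpha>) = {}" using keys by auto
      then show ?thesis using False by (simp add: nu_vertex_def)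
    qed
  qed
  moreover have "nu_vertex [] \<in> cells (cube 0)"
    using bipointed_cube[of 0] by (simp add: bipointed_def is_object_def cube_def)
  ultimately show ?thesis unfolding cube_def bipoint_simps by blast
qed

lemma nu_map_functor:
  assumes basis: "\<And>b. b \<in> basis K \<Longrightarrow> \<phi> b \<in> basis L \<and> deg L (\<phi> b) = deg K b \<and>
      aug L (\<phi> b) = aug K b \<and> bdry L (\<phi> b) = map_chain \<phi> (bdry K b)"
  shows "strict_functor (nu K) (nu L) (nu_map \<phi>)"
proof -
  have bd: "nu_map \<phi> (nu_bd \<alpha> n x) = nu_bd \<alpha> n (nu_map \<phi> x)" for \<alpha> n x
    by (simp add: nu_map_def nu_bd_def fun_eq_iff)
  have cells: "nu_map \<phi> x \<in> cells (nu L)" if x: "x \<in> cells (nu K)" for x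
  proof -
    have keys: "Poly_Mapping.keys (x i \<alpha>) \<subseteq> {b \<in> basis K. deg K b = i}" for i \<alpha>
      using x by (simp add: nu_cells chain_group_def)
    have c: "map_chain \<phi> (x i \<alpha>) \<in> chain_group L i \<and> positive (map_chain \<phi> (x i \<alpha>))" for i \<alpha>
    proof -
      have "b \<in> basis L \<and> deg L b = i" if b: "b \<in> Poly_Mapping.keys (map_chain \<phi> (x i \<alpha>))" for b
      proof -
        obtain a where "a \<in> Poly_Mapping.keys (x i \<alpha>)" "b = \<phi> a"
          using b keys_map_chain[of \<phi> "x i \<alpha>"] by auto
        then show ?thesis using keys[of i \<alpha>] basis[of a] by auto
      qed
      moreover have "positive (x i \<alpha>)" using x by (simp add: nu_cells)
      ultimately show ?thesis by (auto simp: chain_group_def positive_map_chain)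
    qed
    have "aug_chain L (map_chain \<phi> (x 0 \<alpha>)) = 1 * aug_chain K (x 0 \<alpha>)" for \<alpha>
      by (rule aug_chain_map) (use keys basis in auto)
    moreover have "bdry_chain L (map_chain \<phi> (x (Suc i) \<alpha>)) = map_chain \<phi> (bdry_chain K (x (Suc i) \<alpha>))"
      for i \<alpha> by (rule bdry_chain_map_chain) (use keys basis in blast)
    moreover have "\<exists>N. \<forall>i\<ge>N. \<forall>\<alpha>. x i \<alpha> = 0" using x by (simp add: nu_cells)
    then have "\<exists>N. \<forall>i\<ge>N. \<forall>\<alpha>. map_chain \<phi> (x i \<alpha>) = 0" by (metis map_chain_simps(1))
    ultimately show ?thesis using c x by (simp add: nu_cells nu_map_def)
  qed
  have comp: "nu_map \<phi> (comp (nu K) n x y) = comp (nu L) n (nu_map \<phi> x) (nu_map \<phi> y)" for n x y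
    by (simp add: nu_map_def nu_bd_def fun_eq_iff)
  show ?thesis
    unfolding strict_functor_def
    using nu_omega_category[of K] nu_omega_category[of L] cells bd comp by (auto simp del: comp_nu)
qed

lemma nu_map_iso:
  assumes bij: "bij_betw \<phi> (basis K) (basis L)"
    and K: "augmented_directed_complex K"
    and basis: "\<And>b. b \<in> basis K \<Longrightarrow> deg L (\<phi> b) = deg K b \<and>
      aug L (\<phi> b) = aug K b \<and> bdry L (\<phi> b) = map_chain \<phi> (bdry K b)"
  shows "strict_functor (nu K) (nu L) (nu_map \<phi>) \<and>
    bij_betw (nu_map \<phi>) (cells (nu K)) (cells (nu L))"
proof -
  interpret K: augmented_directed_complex K by fact
  define \<psi> where "\<psi> = inv_into (basis K) \<phi>"
  have \<phi>: "\<phi> b \<in> basis L" "\<psi> (\<phi> b) = b" if "b \<in> basis K" for b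
    using bij that by (auto simp: \<psi>_def bij_betw_def inv_into_f_f)
  have \<psi>: "\<psi> b \<in> basis K" "\<phi> (\<psi> b) = b" if "b \<in> basis L" for b
    using bij that unfolding \<psi>_def
    by (auto simp: bij_betw_def inv_into_into f_inv_into_f)
  have F: "strict_functor (nu K) (nu L) (nu_map \<phi>)"
    by (rule nu_map_functor) (use \<phi> basis in auto)
  have inv: "map_chain \<psi> (map_chain \<phi> c) = c" if "Poly_Mapping.keys c \<subseteq> basis K" for c
    using map_chain_cong[of c "\<lambda>b. \<psi> (\<phi> b)" "\<lambda>b. b"] \<phi> that
    by (auto simp: map_chain_compose map_chain_ident)
  have inv': "map_chain \<phi> (map_chain \<psi> c) = c" if "Poly_Mapping.keys c \<subseteq> basis L" for c
    using map_chain_cong[of c "\<lambda>b. \<phi> (\<psi> b)" "\<lambda>b. b"] \<psi> that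
    by (auto simp: map_chain_compose map_chain_ident)
  have G: "strict_functor (nu L) (nu K) (nu_map \<psi>)"
  proof (rule nu_map_functor)
    fix b assume b: "b \<in> basis L"
    have "Poly_Mapping.keys (bdry K (\<psi> b)) \<subseteq> basis K" using K.bdry_chains \<psi>(1)[OF b] by blast
    then show "\<psi> b \<in> basis K \<and> deg K (\<psi> b) = deg L b \<and> aug K (\<psi> b) = aug L b \<and>
        bdry K (\<psi> b) = map_chain \<psi> (bdry L b)"
      using basis[of "\<psi> b"] \<psi>[OF b] inv[of "bdry K (\<psi> b)"] by simp
  qed
  have keys: "Poly_Mapping.keys (x i \<alpha>) \<subseteq> basis K" if "x \<in> cells (nu K)" for x i \<alpha>
    using that by (auto simp: nu_cells chain_group_def)
  have keys': "Poly_Mapping.keys (x i \<alpha>) \<subseteq> basis L" if "x \<in> cells (nu L)" for x i \<alpha>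
    using that by (auto simp: nu_cells chain_group_def)
  have "bij_betw (nu_map \<phi>) (cells (nu K)) (cells (nu L))"
  proof (rule bij_betw_byWitness[where f' = "nu_map \<psi>"])
    show "\<forall>x\<in>cells (nu K). nu_map \<psi> (nu_map \<phi> x) = x"
      by (simp add: nu_map_def inv keys)
    show "\<forall>x\<in>cells (nu L). nu_map \<phi> (nu_map \<psi> x) = x"
      by (simp add: nu_map_def inv' keys')
  qed (use F G in \<open>auto simp: strict_functor_def\<close>)
  with F show ?thesis ..
qed

lemma length_tensor_power: "as \<in> basis (tensor_power K n) \<Longrightarrow> length as = n"
  by (induction n arbitrary: as)
    (auto simp: tensor_power_Suc_simps unit_complex_def simp del: tensor_power.simps(2))

lemma tensor_power_append:
  assumes "as \<in> basis (tensor_power K m)"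
  shows "deg (tensor_power K (m + n)) (as @ bs) =
      deg (tensor_power K m) as + deg (tensor_power K n) bs \<and>
    aug (tensor_power K (m + n)) (as @ bs) = aug (tensor_power K m) as * aug (tensor_power K n) bs \<and>
    bdry (tensor_power K (m + n)) (as @ bs) = map_chain (\<lambda>(xs, ys). xs @ ys)
      (bdry (tensor (tensor_power K m) (tensor_power K n)) (as, bs))"
  using assms
proof (induction m arbitrary: as)
  case 0
  then show ?case by (simp add: unit_complex_def map_chain_compose map_chain_ident)
next
  case (Suc m)
  then obtain a as' where as: "as = a # as'" and as': "as' \<in> basis (tensor_power K m)"
    by (auto simp: tensor_power_Suc_simps simp del: tensor_power.simps(2))
  show ?case
    using Suc.IH[OF as']
    by (simp add: as tensor_power_Suc_simps map_chain_compose frag_cmul_distrib2 power_add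
        add.assoc mult.assoc del: tensor_power.simps(2))
qed

text \<open>The identification of \<open>cube m \<otimes> cube n\<close> with \<open>cube (m + n)\<close>, by concatenation.\<close>

theorem gray_cubes_iso:
  "bipointed_iso (gray_cubes m n) (cube (m + n)) (nu_map (\<lambda>(xs, ys). xs @ ys))"
proof -
  let ?\<phi> = "\<lambda>(xs, ys). xs @ ys :: interval list"
  let ?K = "tensor (cube_complex m) (cube_complex n)"
  have img: "?\<phi> ` (basis (tensor_power K m) \<times> basis (tensor_power K n)) = basis (tensor_power K (m + n))"
    for K :: "interval adc"
  proof (induction m)
    case 0
    show ?case by (force simp: unit_complex_def)
  next
    case (Suc m)
    show ?case
    proof (intro equalityI subsetI)
      fix z assume "z \<in> ?\<phi> ` (basis (tensor_power K (Suc m)) \<times> basis (tensor_power K n))"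
      then show "z \<in> basis (tensor_power K (Suc m + n))"
        unfolding add_Suc tensor_power_Suc_simps Suc[symmetric] by force
    next
      fix z assume "z \<in> basis (tensor_power K (Suc m + n))"
      then obtain a as bs where "z = a # (as @ bs)" "a \<in> basis K"
        "as \<in> basis (tensor_power K m)" "bs \<in> basis (tensor_power K n)"
        unfolding add_Suc tensor_power_Suc_simps Suc[symmetric] by force
      then show "z \<in> ?\<phi> ` (basis (tensor_power K (Suc m)) \<times> basis (tensor_power K n))"
        unfolding tensor_power_Suc_simps by (intro image_eqI[of _ _ "(a # as, bs)"]) auto
    qed
  qed
  have "inj_on ?\<phi> (basis ?K)"
  proof (rule inj_onI)
    fix p q assume p: "p \<in> basis ?K" and q: "q \<in> basis ?K" and eq: "?\<phi> p = ?\<phi> q"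
    have "length (fst p) = length (fst q)"
      using p q length_tensor_power[of _ arrow_complex m] by (auto simp: cube_complex_def)
    then show "p = q" using eq by (cases p, cases q) simp
  qed
  then have "bij_betw ?\<phi> (basis ?K) (basis (cube_complex (m + n)))"
    using img by (simp add: bij_betw_def cube_complex_def)
  moreover have "deg (cube_complex (m + n)) (?\<phi> b) = deg ?K b \<and>
      aug (cube_complex (m + n)) (?\<phi> b) = aug ?K b \<and>
      bdry (cube_complex (m + n)) (?\<phi> b) = map_chain ?\<phi> (bdry ?K b)" if "b \<in> basis ?K" for b
  proof -
    obtain as bs where b: "b = (as, bs)" by (cases b)
    then have "as \<in> basis (tensor_power arrow_complex m)" using that by (simp add: cube_complex_def)
    from tensor_power_append[OF this, of n bs] show ?thesis
      by (simp add: b cube_complex_def del: tensor_simps(3) tensor_power.simps)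
  qed
  ultimately have iso: "strict_functor (nu ?K) (nu (cube_complex (m + n))) (nu_map ?\<phi>) \<and>
      bij_betw (nu_map ?\<phi>) (cells (nu ?K)) (cells (nu (cube_complex (m + n))))"
    by (intro nu_map_iso) (auto simp: tensor_adc cube_complex_adc simp del: tensor_simps)
  have v: "nu_map ?\<phi> (nu_vertex b) = nu_vertex (?\<phi> b)" for b
    by (simp add: nu_map_def nu_vertex_def fun_eq_iff)
  show ?thesis
    using iso bipointed_gray_cubes[of m n] bipointed_cube[of "m + n"]
    by (simp add: bipointed_iso_def bipointed_map_def strict_functor_def cube_def gray_cubes_def
        gray_def v replicate_add)
qed

end

theory Submission
  imports Defs
begin

text \<open>
  No nontrivial cell of a cube starts at its last vertex or ends at its first vertex, because every
  boundary has positive weight for a suitable integral weight on basis elements.  Hence a functor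
  into \<open>\<square>\<^sup>m \<or> \<square>\<^sup>n\<close> is given by functors \<open>p\<close> to \<open>\<square>\<^sup>m\<close> and \<open>q\<close> to \<open>\<square>\<^sup>n\<close> such that every object is sent
  to the gluing point by \<open>p\<close> or by \<open>q\<close>: a cell \<open>z\<close> is sent to the \<open>0\<close>-composite of \<open>p z\<close> and \<open>q z\<close>.
  On \<open>\<square>\<^sup>m \<otimes> \<square>\<^sup>n\<close>, take for \<open>p\<close> the projection, and for \<open>q\<close> the map which is constant on \<open>v \<otimes> \<square>\<^sup>n\<close>
  for every vertex \<open>v\<close> but the last one, where it is the identity; on chains, \<open>q\<close> interpolates by a
  positive contraction of \<open>\<square>\<^sup>n\<close> onto its first vertex.  The section \<open>\<iota>\<close> includes \<open>\<square>\<^sup>m\<close> as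
  \<open>\<square>\<^sup>m \<otimes> 0\<close> and \<open>\<square>\<^sup>n\<close> as \<open>1 \<otimes> \<square>\<^sup>n\<close>.
\<close>

section \<open>Functors out of wedge sums\<close>

lemma strict_functor_bipoint [simp]:
  "strict_functor (bipoint C p q) D F \<longleftrightarrow> strict_functor C D F"
  by (simp add: strict_functor_def)

lemma strict_functor_into_bipoint [simp]:
  "strict_functor C (bipoint D p q) F \<longleftrightarrow> strict_functor C D F"
  by (simp add: strict_functor_def)

lemma strict_functor_compose:
  assumes "strict_functor C D F" "strict_functor D E G"
  shows "strict_functor C E (\<lambda>x. G (F x))"
  using assms unfolding strict_functor_def composable_def
  by (auto simp: Pi_iff) metis

lemma strict_functor_ident: "strict_omega_category C \<Longrightarrow> strict_functor C C (\<lambda>x. x)"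
  by (auto simp: strict_functor_def)

lemma strict_functor_composable:
  assumes "strict_functor C D F" "composable C n x y"
  shows "composable D n (F x) (F y)"
  using assms unfolding strict_functor_def composable_def by (metis PiE)

lemma object_bd:
  assumes "strict_omega_category C" "is_object C x"
  shows "bd C \<alpha> n x = x"
  using strict_omega_category.bd_bd_ge[OF assms(1), of x 0 n \<alpha> Minus] assms(2)
  by (simp add: is_object_def)

lemma object_comp:
  assumes "strict_omega_category C" "is_object C x"
  shows "comp C n x x = x"
  using strict_omega_category.unit_left[OF assms(1), of x n] object_bd[OF assms] assms(2)
  by (simp add: is_object_def)

definition wedge_inl ::
    "('a, 'm) bipointed_ocat_scheme \<Rightarrow> ('b, 'k) bipointed_ocat_scheme \<Rightarrow> 'a \<Rightarrow> ('a, 'b) expr set" where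
  "wedge_inl C D = (\<lambda>x. push_inl (cube 0) (\<lambda>_. second_pt C) (\<lambda>_. first_pt D) C D x)"

definition wedge_inr ::
    "('a, 'm) bipointed_ocat_scheme \<Rightarrow> ('b, 'k) bipointed_ocat_scheme \<Rightarrow> 'b \<Rightarrow> ('a, 'b) expr set" where
  "wedge_inr C D = (\<lambda>y. push_inr (cube 0) (\<lambda>_. second_pt C) (\<lambda>_. first_pt D) C D y)"

lemma wedge_pts:
  "first_pt (wedge C D) = wedge_inl C D (first_pt C)"
  "second_pt (wedge C D) = wedge_inr C D (second_pt D)"
  by (simp_all add: wedge_simps wedge_inl_def wedge_inr_def)

lemma wedge_glue: "wedge_inl C D (second_pt C) = wedge_inr C D (first_pt D)"
  using pushout_glue[of "nu_vertex []" "cube 0" "\<lambda>_. second_pt C" "\<lambda>_. first_pt D" C D]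
  by (simp add: wedge_inl_def wedge_inr_def cells_cube_0)

context
  fixes C :: "('a, 'm) bipointed_ocat_scheme" and D :: "('b, 'k) bipointed_ocat_scheme"
  assumes C: "bipointed C" and D: "bipointed D"
begin

lemma wedge_inl_functor: "strict_functor C (wedge C D) (wedge_inl C D)"
  and wedge_inr_functor: "strict_functor D (wedge C D) (wedge_inr C D)"
  using C D push_inl_functor[of C D "\<lambda>_. second_pt C" "cube 0" "\<lambda>_. first_pt D"]
    push_inr_functor[of C D "\<lambda>_. second_pt C" "cube 0" "\<lambda>_. first_pt D"]
  by (simp_all add: wedge_simps wedge_inl_def wedge_inr_def bipointed_def is_object_def)

lemma wedge_universal:
  assumes u: "strict_functor C E u" and v: "strict_functor D E v"
    and uv: "u (second_pt C) = v (first_pt D)"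
  shows "\<exists>h. strict_functor (wedge C D) E h \<and>
    (\<forall>x\<in>cells C. h (wedge_inl C D x) = u x) \<and> (\<forall>y\<in>cells D. h (wedge_inr C D y) = v y) \<and>
    (\<forall>h'. strict_functor (wedge C D) E h' \<and>
      (\<forall>x\<in>cells C. h' (wedge_inl C D x) = u x) \<and>
      (\<forall>y\<in>cells D. h' (wedge_inr C D y) = v y) \<longrightarrow>
      (\<forall>X\<in>cells (wedge C D). h' X = h X))"
proof -
  have A: "strict_omega_category (cube 0)" using bipointed_cube by (simp add: bipointed_def)
  have f: "strict_functor (cube 0) C (\<lambda>_. second_pt C)"
    and g: "strict_functor (cube 0) D (\<lambda>_. first_pt D)"
    using C D A by (simp_all add: point_functor bipointed_def)
  show ?thesis
    using pushout_universal[OF f g u v] uv by (simp add: wedge_simps wedge_inl_def wedge_inr_def)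
qed

text \<open>Both functors restrict to the same cocone, hence both equal its mediating functor
  \<open>k\<close>. Equality of functors out of the wedge can thus be tested on the two summands,
  without describing the cells of the wedge.\<close>

lemma wedge_functor_unique:
  assumes h: "strict_functor (wedge C D) E h" and h': "strict_functor (wedge C D) E h'"
    and "\<And>x. x \<in> cells C \<Longrightarrow> h (wedge_inl C D x) = h' (wedge_inl C D x)"
    and "\<And>y. y \<in> cells D \<Longrightarrow> h (wedge_inr C D y) = h' (wedge_inr C D y)"
    and X: "X \<in> cells (wedge C D)"
  shows "h X = h' X"
proof -
  have "strict_functor C E (\<lambda>x. h (wedge_inl C D x))" "strict_functor D E (\<lambda>x. h (wedge_inr C D x))"
    using strict_functor_compose[OF wedge_inl_functor h] strict_functor_compose[OF wedge_inr_functor h]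
    by simp_all
  from wedge_universal[OF this] obtain k where
    k: "\<And>h'. strict_functor (wedge C D) E h' \<and>
      (\<forall>x\<in>cells C. h' (wedge_inl C D x) = h (wedge_inl C D x)) \<and>
      (\<forall>y\<in>cells D. h' (wedge_inr C D y) = h (wedge_inr C D y)) \<longrightarrow>
      (\<forall>X\<in>cells (wedge C D). h' X = k X)"
    by (auto simp: wedge_glue)
  then show ?thesis using assms by metis
qed

end


section \<open>Functors into wedge sums\<close>

text \<open>If no nontrivial cell of \<open>C\<close> starts at the gluing point and none of \<open>D\<close> ends there, then a cell
  of \<open>C \<or> D\<close> amounts to a pair of cells of \<open>C\<close> and \<open>D\<close>, either of which may be the gluing point.\<close>

locale wedge_factorization =
  fixes Z :: "('z, 'l) ocat_scheme"
    and C :: "('a, 'm) bipointed_ocat_scheme" and D :: "('b, 'k) bipointed_ocat_scheme"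
    and p :: "'z \<Rightarrow> 'a" and q :: "'z \<Rightarrow> 'b"
  assumes C: "bipointed C" and D: "bipointed D"
    and p: "strict_functor Z C p" and q: "strict_functor Z D q"
    and no_exit: "x \<in> cells C \<Longrightarrow> bd C Minus 0 x = second_pt C \<Longrightarrow> x = second_pt C"
    and no_entry: "y \<in> cells D \<Longrightarrow> bd D Plus 0 y = first_pt D \<Longrightarrow> y = first_pt D"
    and objects: "is_object Z z \<Longrightarrow> p z = second_pt C \<or> q z = first_pt D"
begin

abbreviation (input) "c \<equiv> second_pt C"
abbreviation (input) "d \<equiv> first_pt D"
abbreviation (input) "W \<equiv> wedge C D"
abbreviation (input) "inl \<equiv> wedge_inl C D"
abbreviation (input) "inr \<equiv> wedge_inr C D"

definition through :: "'z \<Rightarrow> bool" where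
  "through z \<longleftrightarrow> bd C Plus 0 (p z) = c \<and> bd D Minus 0 (q z) = d"

text \<open>If \<open>q z\<close> is constant at the gluing point, \<open>p z\<close> may end
  elsewhere, and dually; the 0-composite is then undefined, so the constant cases are treated
  separately.\<close>

definition join :: "'z \<Rightarrow> ('a, 'b) expr set" where
  "join z = (if q z = d then inl (p z) else if p z = c then inr (q z)
     else comp W 0 (inl (p z)) (inr (q z)))"

sublocale Z: strict_omega_category Z using p by (simp add: strict_functor_def)
sublocale C: strict_omega_category C using C by (simp add: bipointed_def)
sublocale D: strict_omega_category D using D by (simp add: bipointed_def)
sublocale W: strict_omega_category W using bipointed_wedge[OF C D] by (simp add: bipointed_def)

lemma c: "is_object C c" and d: "is_object D d"
  using C D by (simp_all add: bipointed_def)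

lemma pt_simps [simp]:
  "c \<in> cells C" "d \<in> cells D" "bd C \<alpha> n c = c" "bd D \<alpha> n d = d" "comp C n c c = c" "comp D n d d = d"
  using c d by (simp_all add: object_bd[OF C.strict_omega_category_axioms]
      object_bd[OF D.strict_omega_category_axioms] object_comp[OF C.strict_omega_category_axioms]
      object_comp[OF D.strict_omega_category_axioms]) (simp_all add: is_object_def)

lemma p_simps:
  "z \<in> cells Z \<Longrightarrow> p z \<in> cells C" "z \<in> cells Z \<Longrightarrow> p (bd Z \<alpha> n z) = bd C \<alpha> n (p z)"
  "composable Z n z z' \<Longrightarrow> p (comp Z n z z') = comp C n (p z) (p z')"
  using p by (auto simp: strict_functor_def)

lemma q_simps:
  "z \<in> cells Z \<Longrightarrow> q z \<in> cells D" "z \<in> cells Z \<Longrightarrow> q (bd Z \<alpha> n z) = bd D \<alpha> n (q z)"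
  "composable Z n z z' \<Longrightarrow> q (comp Z n z z') = comp D n (q z) (q z')"
  using q by (auto simp: strict_functor_def)

lemma inl_simps:
  "x \<in> cells C \<Longrightarrow> inl x \<in> cells W" "x \<in> cells C \<Longrightarrow> bd W \<alpha> n (inl x) = inl (bd C \<alpha> n x)"
  "composable C n x x' \<Longrightarrow> comp W n (inl x) (inl x') = inl (comp C n x x')"
  using wedge_inl_functor[OF C D] by (auto simp: strict_functor_def)

lemma inr_simps:
  "y \<in> cells D \<Longrightarrow> inr y \<in> cells W" "y \<in> cells D \<Longrightarrow> bd W \<alpha> n (inr y) = inr (bd D \<alpha> n y)"
  "composable D n y y' \<Longrightarrow> comp W n (inr y) (inr y') = inr (comp D n y y')"
  using wedge_inr_functor[OF C D] by (auto simp: strict_functor_def)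

text \<open>Apply \<open>objects\<close> to the 0-source and the 0-target of \<open>z\<close>. If
  \<open>p\<close> hits the gluing point at the source, \<open>no_exit\<close> makes
  \<open>p z\<close> constant; if \<open>q\<close> hits it at the target, \<open>no_entry\<close>
  makes \<open>q z\<close> constant. What remains is \<open>through z\<close>.\<close>

lemma cell_cases:
  assumes z: "z \<in> cells Z"
  obtains "p z = c" | "q z = d" | "through z"
proof -
  have o: "is_object Z (bd Z \<alpha> 0 z)" for \<alpha>
    using z by (simp add: is_object_def Z.bd_closed Z.bd_bd_ge)
  show ?thesis
    using that objects[OF o[of Minus]] objects[OF o[of Plus]] no_exit[of "p z"] no_entry[of "q z"]
    by (auto simp: through_def p_simps q_simps z)
qed

lemma join_inl: "q z = d \<Longrightarrow> join z = inl (p z)"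
  by (simp add: join_def)

lemma join_inr: "p z = c \<Longrightarrow> join z = inr (q z)"
  by (simp add: join_def wedge_glue)

lemma through_composable:
  "z \<in> cells Z \<Longrightarrow> through z \<Longrightarrow> composable W 0 (inl (p z)) (inr (q z))"
  by (simp add: composable_def through_def inl_simps inr_simps p_simps q_simps wedge_glue)

text \<open>The overlaps in the definition of \<open>join\<close> are harmless: a constant factor is
  an identity on the gluing point, and the composite collapses by a unit law.\<close>

lemma join_through:
  assumes z: "z \<in> cells Z" and t: "through z"
  shows "join z = comp W 0 (inl (p z)) (inr (q z))"
proof -
  have "comp W 0 (inl (p z)) (inr d) = inl (p z)"
    using W.unit_right[of "inl (p z)" 0] z t
    by (simp add: inl_simps p_simps through_def wedge_glue)
  moreover have "comp W 0 (inl c) (inr (q z)) = inr (q z)"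
    using W.unit_left[of "inr (q z)" 0] z t
    by (simp add: inr_simps q_simps through_def wedge_glue)
  ultimately show ?thesis by (auto simp: join_def)
qed

lemma join_cell: assumes z: "z \<in> cells Z" shows "join z \<in> cells W"
  using z by (cases rule: cell_cases)
    (simp_all add: join_inl join_inr join_through z through_composable W.comp_closed
      inl_simps inr_simps p_simps q_simps)

lemma join_bd: assumes z: "z \<in> cells Z" shows "join (bd Z \<alpha> n z) = bd W \<alpha> n (join z)"
  using z
proof (cases rule: cell_cases)
  case 1
  then show ?thesis using z by (simp add: join_inr p_simps q_simps inr_simps)
next
  case 2
  then show ?thesis using z by (simp add: join_inl p_simps q_simps inl_simps)
next
  case 3
  note comp = through_composable[OF z 3]
  show ?thesis
  proof (cases "n = 0")
    case True
    show ?thesis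
    proof (cases \<alpha>)
      case Minus
      then have "q (bd Z \<alpha> n z) = d" using z 3 True by (simp add: q_simps through_def)
      then show ?thesis
        using z 3 True Minus W.source_comp[OF comp]
        by (simp add: join_inl join_through p_simps inl_simps)
    next
      case Plus
      then have "p (bd Z \<alpha> n z) = c" using z 3 True by (simp add: p_simps through_def)
      then show ?thesis
        using z 3 True Plus W.target_comp[OF comp]
        by (simp add: join_inr join_through q_simps inr_simps)
    qed
  next
    case False
    \<comment> \<open>For \<open>n > 0\<close> the \<open>n\<close>-boundary keeps the 0-source and
      the 0-target.\<close>
    have "through (bd Z \<alpha> n z)"
      using z 3 False by (simp add: through_def p_simps q_simps C.bd_bd_less D.bd_bd_less)
    then show ?thesis
      using z 3 False W.bd_comp_greater[OF comp, of n \<alpha>]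
      by (simp add: join_through Z.bd_closed p_simps q_simps inl_simps inr_simps)
  qed
qed

text \<open>Cells composable in dimension \<open>n > 0\<close> share their 0-source and 0-target, so
  both fall under the same case of \<open>cell_cases\<close>. In the \<open>through\<close> case the
  claim is the interchange law.\<close>

lemma join_comp_positive:
  assumes zz': "composable Z n z z'" and n: "0 < n"
  shows "join (comp Z n z z') = comp W n (join z) (join z')"
proof -
  have z: "z \<in> cells Z" and z': "z' \<in> cells Z" using zz' by (auto simp: composable_def)
  note pc = strict_functor_composable[OF p zz'] and qc = strict_functor_composable[OF q zz']
  have bd: "bd Z \<alpha> 0 z = bd Z \<alpha> 0 z'" for \<alpha>
    using zz' n Z.bd_bd_less[OF z, of 0 n \<alpha> Plus] Z.bd_bd_less[OF z', of 0 n \<alpha> Minus]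
    by (simp add: composable_def)
  then have pbd: "bd C \<alpha> 0 (p z) = bd C \<alpha> 0 (p z')" and qbd: "bd D \<alpha> 0 (q z) = bd D \<alpha> 0 (q z')" for \<alpha>
    using p_simps(2)[OF z, of \<alpha> 0] p_simps(2)[OF z', of \<alpha> 0] q_simps(2)[OF z, of \<alpha> 0]
      q_simps(2)[OF z', of \<alpha> 0] by simp_all
  show ?thesis
    using z
  proof (cases rule: cell_cases)
    case 1
    then have "p z' = c" using no_exit[of "p z'"] pbd[of Minus] z' by (simp add: p_simps)
    then show ?thesis using 1 zz' qc by (simp add: join_inr p_simps q_simps inr_simps)
  next
    case 2
    then have "q z' = d" using no_entry[of "q z'"] qbd[of Plus] z' by (simp add: q_simps)
    then show ?thesis using 2 zz' pc by (simp add: join_inl p_simps q_simps inl_simps)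
  next
    case 3
    then have t': "through z'" using pbd[of Plus] qbd[of Minus] by (simp add: through_def)
    have t: "through (comp Z n z z')"
      using 3 zz' n by (simp add: through_def p_simps q_simps C.bd_comp_less[OF pc] D.bd_comp_less[OF qc])
    have "comp W n (comp W 0 (inl (p z)) (inr (q z))) (comp W 0 (inl (p z')) (inr (q z'))) =
        comp W 0 (comp W n (inl (p z)) (inl (p z'))) (comp W n (inr (q z)) (inr (q z')))"
      using W.interchange[OF n strict_functor_composable[OF wedge_inl_functor[OF C D] pc]
          strict_functor_composable[OF wedge_inr_functor[OF C D] qc]
          through_composable[OF z 3] through_composable[OF z' t']] by simp
    then show ?thesis
      using 3 t t' z z' zz' pc qc
      by (simp add: join_through Z.comp_closed p_simps q_simps inl_simps inr_simps)
  qed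
qed

text \<open>The middle object goes to the gluing point under \<open>p\<close> or under
  \<open>q\<close>. In the first case \<open>p z'\<close> is constant, in the second
  \<open>q z\<close> is, so at most three factors remain to be composed and associativity
  suffices.\<close>

lemma join_comp_zero:
  assumes zz': "composable Z 0 z z'"
  shows "join (comp Z 0 z z') = comp W 0 (join z) (join z')"
proof -
  have z: "z \<in> cells Z" and z': "z' \<in> cells Z" using zz' by (auto simp: composable_def)
  note pc = strict_functor_composable[OF p zz'] and qc = strict_functor_composable[OF q zz']
  note ipc = strict_functor_composable[OF wedge_inl_functor[OF C D] pc]
    and iqc = strict_functor_composable[OF wedge_inr_functor[OF C D] qc]
  have zz: "comp Z 0 z z' \<in> cells Z" using zz' by (rule Z.comp_closed)
  have "is_object Z (bd Z Plus 0 z)"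
    using z by (simp add: is_object_def Z.bd_closed Z.bd_bd_ge)
  then consider (c) "bd C Plus 0 (p z) = c" | (d) "bd D Plus 0 (q z) = d"
    using objects z by (metis p_simps(2) q_simps(2))
  then show ?thesis
  proof cases
    case c
    then have "bd C Minus 0 (p z') = c" using pc by (simp add: composable_def)
    then have pz': "p z' = c" using no_exit z' by (simp add: p_simps)
    have pzz: "p (comp Z 0 z z') = p z"
      using C.unit_right[of "p z" 0] c zz' z pz' by (simp add: p_simps)
    \<comment> \<open>This also covers \<open>q z = d\<close>: as \<open>p z\<close> ends at the
      gluing point here, such a \<open>z\<close> satisfies \<open>through\<close>.\<close>
    have *: ?thesis if t: "through z"
    proof -
      have "through (comp Z 0 z z')"
        using t pzz D.source_comp[OF qc] zz' by (simp add: through_def q_simps)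
      then have "join (comp Z 0 z z') = comp W 0 (inl (p z)) (comp W 0 (inr (q z)) (inr (q z')))"
        using pzz zz zz' qc by (simp add: join_through q_simps inr_simps)
      then show ?thesis
        using W.comp_assoc[OF through_composable[OF z t] iqc] z t pz'
        by (simp add: join_through join_inr)
    qed
    show ?thesis
      using z
    proof (cases rule: cell_cases)
      case 1
      then show ?thesis using pzz pz' zz' qc by (simp add: join_inr q_simps inr_simps)
    next
      case 2
      with c show ?thesis by (intro *) (simp add: through_def)
    qed (rule *)
  next
    case d
    then have qz: "q z = d" using no_entry z by (simp add: q_simps)
    then have "bd D Minus 0 (q z') = d" using qc by (simp add: composable_def)
    then have qzz: "q (comp Z 0 z z') = q z'"
      using D.unit_left[of "q z'" 0] zz' z' qz by (simp add: q_simps)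
    have *: ?thesis if t: "through z'"
    proof -
      have "through (comp Z 0 z z')"
        using t qzz C.target_comp[OF pc] zz' by (simp add: through_def p_simps)
      then have "join (comp Z 0 z z') = comp W 0 (comp W 0 (inl (p z)) (inl (p z'))) (inr (q z'))"
        using qzz zz zz' pc by (simp add: join_through p_simps inl_simps)
      then show ?thesis
        using W.comp_assoc[OF ipc through_composable[OF z' t]] z' t qz
        by (simp add: join_through join_inl)
    qed
    show ?thesis
      using z'
    proof (cases rule: cell_cases)
      case 1
      with \<open>bd D Minus 0 (q z') = d\<close> show ?thesis by (intro *) (simp add: through_def)
    next
      case 2
      then show ?thesis using qzz qz zz' pc by (simp add: join_inl p_simps inl_simps)
    qed (rule *)
  qed
qed

lemma join_functor: "strict_functor Z W join"
  unfolding strict_functor_def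
  using Z.strict_omega_category_axioms W.strict_omega_category_axioms
    join_cell join_bd join_comp_positive join_comp_zero by blast

end


section \<open>Functors induced by chain maps\<close>

lemma frag_extend_map_chain: "frag_extend F (map_chain \<phi> c) = frag_extend (\<lambda>b. F (\<phi> b)) c"
  using frag_extend_compose[of F \<phi> c] by (simp add: map_chain_def o_def)

lemma frag_extend_frag_extend:
  "frag_extend (\<lambda>b. frag_extend F (G b)) c = frag_extend F (frag_extend G c)"
  using subset_UNIV[of "Poly_Mapping.keys c"]
  by (induction c rule: frag_induction) (simp_all add: frag_extend_diff)

lemma map_chain_frag_extend:
  "frag_extend (\<lambda>b. map_chain \<phi> (F b)) c = map_chain \<phi> (frag_extend F c)"
  unfolding map_chain_def by (rule frag_extend_frag_extend)

text \<open>A map that is the augmentation times a fixed chain kills boundaries of basis elements,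
  since these have augmentation 0.\<close>

lemma frag_extend_aug:
  "frag_extend (\<lambda>b. frag_cmul (aug K b) v) c = frag_cmul (aug_chain K c) v"
  using subset_UNIV[of "Poly_Mapping.keys c"]
  by (induction c rule: frag_induction) (simp_all add: frag_extend_diff frag_cmul_diff_distrib)

lemma frag_extend_chain_group:
  assumes "\<And>b. b \<in> basis K \<Longrightarrow> deg K b = n \<Longrightarrow> F b \<in> chain_group L k"
    and "c \<in> chain_group K n"
  shows "frag_extend F c \<in> chain_group L k"
  using assms keys_frag_extend[of F c] unfolding chain_group_def by fastforce

lemma map_chain_chain_group:
  assumes "\<And>b. b \<in> basis K \<Longrightarrow> deg K b = n \<Longrightarrow> \<phi> b \<in> basis L \<and> deg L (\<phi> b) = k"
    and "c \<in> chain_group K n"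
  shows "map_chain \<phi> c \<in> chain_group L k"
  unfolding map_chain_def using assms
  by (intro frag_extend_chain_group[of K n]) (auto simp: chain_group_simps)

lemma positive_frag_extend:
  assumes "\<And>b. b \<in> Poly_Mapping.keys c \<Longrightarrow> positive (F b)" "positive c"
  shows "positive (frag_extend F c)"
  using assms unfolding positive_def frag_extend_def
  by (auto simp: lookup_sum intro!: sum_nonneg)

lemma aug_chain_frag_extend:
  assumes "\<And>b. b \<in> Poly_Mapping.keys c \<Longrightarrow> aug_chain L (F b) = aug K b"
  shows "aug_chain L (frag_extend F c) = aug_chain K c"
proof -
  have "Poly_Mapping.keys c \<subseteq> {b. aug_chain L (F b) = aug K b}" using assms by blast
  then show ?thesis by (induction c rule: frag_induction) (simp_all add: frag_extend_diff)
qed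

lemma bdry_chain_frag_extend:
  assumes "\<And>b. b \<in> Poly_Mapping.keys c \<Longrightarrow> bdry_chain L (F b) = frag_extend F (bdry K b)"
  shows "bdry_chain L (frag_extend F c) = frag_extend F (bdry_chain K c)"
proof -
  have "Poly_Mapping.keys c \<subseteq> {b. bdry_chain L (F b) = frag_extend F (bdry K b)}" using assms by blast
  then show ?thesis by (induction c rule: frag_induction) (simp_all add: frag_extend_diff)
qed

text \<open>Unlike \<open>nu_map\<close>, this lets a basis element go to 0 or to a sum of basis
  elements, as both projections require.\<close>

definition nu_extend :: "('a \<Rightarrow> 'b \<Rightarrow>\<^sub>0 int) \<Rightarrow> (nat \<Rightarrow> polarity \<Rightarrow> 'a \<Rightarrow>\<^sub>0 int) \<Rightarrow>
    nat \<Rightarrow> polarity \<Rightarrow> 'b \<Rightarrow>\<^sub>0 int" where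
  "nu_extend F x = (\<lambda>i \<alpha>. frag_extend F (x i \<alpha>))"

lemma nu_extend_nu_map: "nu_extend F (nu_map \<phi> x) = nu_extend (\<lambda>b. F (\<phi> b)) x"
  by (simp add: nu_extend_def nu_map_def frag_extend_map_chain)

lemma nu_map_nu_map: "nu_map \<psi> (nu_map \<phi> x) = nu_map (\<lambda>b. \<psi> (\<phi> b)) x"
  by (simp add: nu_map_def map_chain_compose)

lemma nu_map_nu_vertex: "nu_map \<phi> (nu_vertex b) = nu_vertex (\<phi> b)"
  by (simp add: nu_map_def nu_vertex_def fun_eq_iff)

lemma nu_extend_nu_vertex: "F b = frag_of v \<Longrightarrow> nu_extend F (nu_vertex b) = nu_vertex v"
  by (simp add: nu_extend_def nu_vertex_def fun_eq_iff)

text \<open>The hypotheses say that \<open>F\<close> extends to a positive, augmentation-preserving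
  chain map, that is, to a morphism of augmented directed complexes; these preserve all conditions
  defining the cells of \<open>nu\<close>.\<close>

lemma nu_extend_functor:
  assumes F: "\<And>b. b \<in> basis K \<Longrightarrow> F b \<in> chain_group L (deg K b)"
    "\<And>b. b \<in> basis K \<Longrightarrow> positive (F b)"
    "\<And>b. b \<in> basis K \<Longrightarrow> aug_chain L (F b) = aug K b"
    "\<And>b. b \<in> basis K \<Longrightarrow> bdry_chain L (F b) = frag_extend F (bdry K b)"
  shows "strict_functor (nu K) (nu L) (nu_extend F)"
proof -
  have bd: "nu_extend F (nu_bd \<alpha> n x) = nu_bd \<alpha> n (nu_extend F x)" for \<alpha> n x
    by (simp add: nu_extend_def nu_bd_def fun_eq_iff)
  have comp: "nu_extend F (comp (nu K) n x y) = comp (nu L) n (nu_extend F x) (nu_extend F y)" for n x y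
    by (simp add: nu_extend_def nu_bd_def fun_eq_iff frag_extend_diff frag_extend_add)
  have cells: "nu_extend F x \<in> cells (nu L)" if x: "x \<in> cells (nu K)" for x
  proof -
    have keys: "b \<in> basis K" if "b \<in> Poly_Mapping.keys (x i \<alpha>)" for b i \<alpha>
      using x that by (auto simp: nu_cells chain_group_def)
    have "\<exists>N. \<forall>i\<ge>N. \<forall>\<alpha>. x i \<alpha> = 0" using x by (simp add: nu_cells)
    then have "\<exists>N. \<forall>i\<ge>N. \<forall>\<alpha>. frag_extend F (x i \<alpha>) = 0" by (metis frag_extend_0)
    moreover have "frag_extend F (x i \<alpha>) \<in> chain_group L i" for i \<alpha>
      by (rule frag_extend_chain_group[of K i]) (use x F(1) in \<open>auto simp: nu_cells\<close>)
    moreover have "positive (frag_extend F (x i \<alpha>))" for i \<alpha>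
      by (rule positive_frag_extend) (use x F(2) keys in \<open>auto simp: nu_cells\<close>)
    moreover have "aug_chain L (frag_extend F (x 0 \<alpha>)) = 1" for \<alpha>
      using aug_chain_frag_extend[of "x 0 \<alpha>" L F K] F(3) keys x by (auto simp: nu_cells)
    moreover have "bdry_chain L (frag_extend F (x (Suc i) \<alpha>)) =
        frag_extend F (x i Plus) - frag_extend F (x i Minus)" for i \<alpha>
      using bdry_chain_frag_extend[of "x (Suc i) \<alpha>" L F K] F(4) keys x
      by (auto simp: nu_cells frag_extend_diff)
    ultimately show ?thesis by (simp add: nu_cells nu_extend_def)
  qed
  show ?thesis
    unfolding strict_functor_def
    using nu_omega_category[of K] nu_omega_category[of L] cells bd comp by (auto simp del: comp_nu)
qed

lemma nu_extend_eq_ident: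
  assumes "x \<in> cells (nu K)" "\<And>b. b \<in> basis K \<Longrightarrow> F b = frag_of b"
  shows "nu_extend F x = x"
proof (intro ext)
  fix i \<alpha>
  have "frag_extend F (x i \<alpha>) = frag_extend frag_of (x i \<alpha>)"
    by (rule frag_extend_eq) (use assms in \<open>auto simp: nu_cells chain_group_def\<close>)
  then show "nu_extend F x i \<alpha> = x i \<alpha>" by (simp add: nu_extend_def flip: frag_expansion)
qed

text \<open>Such a chain map factors through the augmentation, which vanishes in positive degrees
  and is 1 on the degree 0 chains of a cell.\<close>

lemma nu_extend_eq_vertex:
  assumes "augmented_directed_complex K" "x \<in> cells (nu K)"
    and "\<And>b. b \<in> basis K \<Longrightarrow> F b = frag_cmul (aug K b) (frag_of v)"
  shows "nu_extend F x = nu_vertex v"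
proof (intro ext)
  fix i \<alpha>
  have c: "x i \<alpha> \<in> chain_group K i" "aug_chain K (x 0 \<alpha>) = 1" using assms(2) by (auto simp: nu_cells)
  then have "frag_extend F (x i \<alpha>) = frag_extend (\<lambda>b. frag_cmul (aug K b) (frag_of v)) (x i \<alpha>)"
    by (intro frag_extend_eq assms(3)) (auto simp: chain_group_def)
  moreover have "aug_chain K (x i \<alpha>) = 0" if "i \<noteq> 0"
    unfolding aug_chain_def
    using c that augmented_directed_complex.aug_pos_deg[OF assms(1)]
    by (intro sum.neutral) (auto simp: chain_group_def)
  ultimately show "nu_extend F x i \<alpha> = nu_vertex v i \<alpha>"
    using c by (auto simp: nu_extend_def nu_vertex_def frag_extend_aug)
qed

section \<open>The chain complex of a cube\<close>

lemma cube_complex_0: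
  "basis (cube_complex 0) = {[]}" "deg (cube_complex 0) c = 0" "bdry (cube_complex 0) c = 0"
  "aug (cube_complex 0) c = 1"
  by (simp_all add: cube_complex_def unit_complex_def)

lemma basis_cube_complex: "c \<in> basis (cube_complex n) \<longleftrightarrow> length c = n"
  unfolding cube_complex_def
  by (induction n arbitrary: c)
    (auto simp: unit_complex_def tensor_power_Suc_simps arrow_complex_def length_Suc_conv
      simp del: tensor_power.simps(2))

lemma cube_complex_Suc:
  "deg (cube_complex (Suc n)) (V0 # c) = deg (cube_complex n) c"
  "deg (cube_complex (Suc n)) (V1 # c) = deg (cube_complex n) c"
  "deg (cube_complex (Suc n)) (E01 # c) = Suc (deg (cube_complex n) c)"
  "aug (cube_complex (Suc n)) (V0 # c) = aug (cube_complex n) c"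
  "aug (cube_complex (Suc n)) (V1 # c) = aug (cube_complex n) c"
  "aug (cube_complex (Suc n)) (E01 # c) = 0"
  "bdry (cube_complex (Suc n)) (V0 # c) = map_chain ((#) V0) (bdry (cube_complex n) c)"
  "bdry (cube_complex (Suc n)) (V1 # c) = map_chain ((#) V1) (bdry (cube_complex n) c)"
  "bdry (cube_complex (Suc n)) (E01 # c) =
    frag_of (V1 # c) - frag_of (V0 # c) - map_chain ((#) E01) (bdry (cube_complex n) c)"
  unfolding cube_complex_def
  by (simp_all add: tensor_power_Suc_simps arrow_complex_def del: tensor_power.simps(2))

lemma deg_cube_complex: "length c = n \<Longrightarrow> deg (cube_complex n) c = count_list c E01"
proof (induction n arbitrary: c)
  case (Suc n)
  then obtain x c' where c: "c = x # c'" "length c' = n" by (auto simp: length_Suc_conv)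
  then show ?case using Suc.IH[of c'] by (cases x) (simp_all add: cube_complex_Suc)
qed (simp add: cube_complex_0)

lemma aug_cube_complex: "length c = n \<Longrightarrow> aug (cube_complex n) c = (if E01 \<in> set c then 0 else 1)"
proof (induction n arbitrary: c)
  case (Suc n)
  then obtain x c' where c: "c = x # c'" "length c' = n" by (auto simp: length_Suc_conv)
  then show ?case using Suc.IH[of c'] by (cases x) (simp_all add: cube_complex_Suc)
qed (simp add: cube_complex_0)

lemma keys_bdry_cube:
  assumes "length c = n" "b \<in> Poly_Mapping.keys (bdry (cube_complex n) c)"
  shows "length b = n"
  using augmented_directed_complex.bdry_chains[OF cube_complex_adc, of c n b] assms
  by (simp add: basis_cube_complex)

lemma bdry_cube_vertex:
  assumes "v \<noteq> E01"
  shows "bdry (cube_complex n) (replicate n v) = 0"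
proof -
  have "Poly_Mapping.keys (bdry (cube_complex n) (replicate n v)) = {}"
    using augmented_directed_complex.bdry_chains[OF cube_complex_adc, of "replicate n v" n]
      cube_complex_vertex[OF assms, of n] by force
  then show ?thesis by simp
qed

lemma bdry_chain_Cons:
  "bdry_chain (cube_complex (Suc n)) (map_chain ((#) V0) c) =
    map_chain ((#) V0) (bdry_chain (cube_complex n) c)"
  "bdry_chain (cube_complex (Suc n)) (map_chain ((#) V1) c) =
    map_chain ((#) V1) (bdry_chain (cube_complex n) c)"
  "bdry_chain (cube_complex (Suc n)) (map_chain ((#) E01) c) =
    map_chain ((#) V1) c - map_chain ((#) V0) c -
    map_chain ((#) E01) (bdry_chain (cube_complex n) c)"
proof -
  let ?V = "\<lambda>n. bdry_chain (cube_complex n)"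
  have "?V (Suc n) (map_chain ((#) V0) c) = map_chain ((#) V0) (?V n c) \<and>
    ?V (Suc n) (map_chain ((#) V1) c) = map_chain ((#) V1) (?V n c) \<and>
    ?V (Suc n) (map_chain ((#) E01) c) =
      map_chain ((#) V1) c - map_chain ((#) V0) c - map_chain ((#) E01) (?V n c)"
    using subset_UNIV[of "Poly_Mapping.keys c"]
  proof (induction c rule: frag_induction)
    case (diff a b)
    then show ?case by (simp only: map_chain_simps bdry_chain_simps) (simp add: algebra_simps)
  qed (simp_all add: cube_complex_Suc)
  then show "?V (Suc n) (map_chain ((#) V0) c) = map_chain ((#) V0) (?V n c)"
    "?V (Suc n) (map_chain ((#) V1) c) = map_chain ((#) V1) (?V n c)"
    "?V (Suc n) (map_chain ((#) E01) c) =
      map_chain ((#) V1) c - map_chain ((#) V0) c - map_chain ((#) E01) (?V n c)" by simp_all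
qed


section \<open>The two projections\<close>

text \<open>The identity on the first \<open>m\<close> coordinates tensored with the augmentation of
  the remaining ones.\<close>

definition front_proj :: "nat \<Rightarrow> interval list \<Rightarrow> interval list \<Rightarrow>\<^sub>0 int" where
  "front_proj m c = (if E01 \<in> set (drop m c) then 0 else frag_of (take m c))"

lemma front_proj_simps:
  "front_proj 0 c = (if E01 \<in> set c then 0 else frag_of [])"
  "front_proj (Suc m) (x # c) = map_chain ((#) x) (front_proj m c)"
  by (simp_all add: front_proj_def)

lemma bdry_front_proj:
  assumes "length c = m + n"
  shows "bdry_chain (cube_complex m) (front_proj m c) =
    frag_extend (front_proj m) (bdry (cube_complex (m + n)) c)"
  using assms
proof (induction m arbitrary: c)
  case 0
  \<comment> \<open>With no coordinate left to keep, the map is the augmentation, which kills the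
    boundary.\<close>
  have "frag_extend (front_proj 0) (bdry (cube_complex n) c) =
      frag_extend (\<lambda>b. frag_cmul (aug (cube_complex n) b) (frag_of [])) (bdry (cube_complex n) c)"
    by (rule frag_extend_eq) (use keys_bdry_cube[of c n] 0 in \<open>auto simp: front_proj_simps aug_cube_complex\<close>)
  then show ?case
    using 0 augmented_directed_complex.aug_bdry[OF cube_complex_adc, of c n]
    by (simp add: frag_extend_aug basis_cube_complex front_proj_simps(1)[of c] cube_complex_0)
next
  case (Suc m)
  then obtain x c' where c: "c = x # c'" and c': "length c' = m + n" by (auto simp: length_Suc_conv)
  show ?case
    using Suc.IH[OF c'] unfolding c
    by (cases x) (simp_all add: front_proj_simps bdry_chain_Cons cube_complex_Suc
        frag_extend_diff frag_extend_map_chain map_chain_frag_extend)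
qed

lemma front_proj_functor:
  "strict_functor (cube (m + n)) (cube m) (nu_extend (front_proj m))"
proof -
  have "strict_functor (nu (cube_complex (m + n))) (nu (cube_complex m)) (nu_extend (front_proj m))"
  proof (rule nu_extend_functor)
    fix c assume "c \<in> basis (cube_complex (m + n))"
    then have c: "length c = m + n" by (simp add: basis_cube_complex)
    have split: "c = take m c @ drop m c" by simp
    have "count_list c E01 = count_list (take m c) E01" if "E01 \<notin> set (drop m c)"
      using that by (subst split, subst count_list_append) simp
    then show "front_proj m c \<in> chain_group (cube_complex m) (deg (cube_complex (m + n)) c)"
      using c by (auto simp: front_proj_def chain_group_simps basis_cube_complex deg_cube_complex)
    show "positive (front_proj m c)" by (simp add: front_proj_def positive_simps)
    have "E01 \<in> set c \<longleftrightarrow> E01 \<in> set (take m c) \<or> E01 \<in> set (drop m c)"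
      by (subst split, subst set_append) blast
    then show "aug_chain (cube_complex m) (front_proj m c) = aug (cube_complex (m + n)) c"
      using c by (simp add: front_proj_def aug_cube_complex)
  qed (simp add: bdry_front_proj basis_cube_complex)
  then show ?thesis by (simp add: cube_def)
qed

text \<open>A positive chain contraction of the cube onto its initial vertex: the tensor power of the
  contraction \<open>V0 \<mapsto> 0, V1 \<mapsto> E01\<close> of the interval.\<close>

fun contraction :: "interval list \<Rightarrow> interval list \<Rightarrow>\<^sub>0 int" where
  "contraction [] = 0"
| "contraction (V0 # c) = map_chain ((#) V0) (contraction c)"
| "contraction (V1 # c) = frag_of (E01 # c) + map_chain ((#) V0) (contraction c)"
| "contraction (E01 # c) = 0"

lemma contraction_chain_group:
  "contraction c \<in> chain_group (cube_complex (length c)) (Suc (deg (cube_complex (length c)) c))"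
proof (induction c rule: contraction.induct)
  case (2 c)
  have "map_chain ((#) V0) (contraction c) \<in>
      chain_group (cube_complex (Suc (length c))) (Suc (deg (cube_complex (length c)) c))"
    by (rule map_chain_chain_group[OF _ 2]) (auto simp: cube_complex_Suc basis_cube_complex)
  then show ?case by (simp add: cube_complex_Suc)
next
  case (3 c)
  have "map_chain ((#) V0) (contraction c) \<in>
      chain_group (cube_complex (Suc (length c))) (Suc (deg (cube_complex (length c)) c))"
    by (rule map_chain_chain_group[OF _ 3]) (auto simp: cube_complex_Suc basis_cube_complex)
  then show ?case by (simp add: cube_complex_Suc basis_cube_complex chain_group_simps)
qed (simp_all add: chain_group_simps)

lemma positive_contraction: "positive (contraction c)"
  by (induction c rule: contraction.induct) (simp_all add: positive_simps positive_map_chain)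

lemma contraction_replicate: "contraction (replicate n V0) = 0"
  by (induction n) simp_all

text \<open>The homotopy identity \<open>d h + h d = id - e\<close>, with \<open>h\<close> the
  contraction and \<open>e\<close> the augmentation followed by the initial vertex. For
  \<open>V1 # c\<close> the edge \<open>E01 # c\<close> supplies \<open>V1 # c - V0 # c\<close>, and
  the rest is the identity for \<open>c\<close>. For \<open>E01 # c\<close> the contractions of the
  two end faces differ by exactly \<open>E01 # c\<close>.\<close>

lemma bdry_contraction:
  "bdry_chain (cube_complex (length c)) (contraction c) =
    frag_of c - frag_cmul (aug (cube_complex (length c)) c) (frag_of (replicate (length c) V0)) -
    frag_extend contraction (bdry (cube_complex (length c)) c)"
proof (induction c rule: contraction.induct)
  case (4 c)
  then show ?case
    by (simp add: cube_complex_Suc frag_extend_diff frag_extend_map_chain frag_extend_eq_0)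
next
  case (3 c)
  have "frag_extend contraction (map_chain ((#) V1) (bdry (cube_complex (length c)) c)) =
      map_chain ((#) E01) (bdry (cube_complex (length c)) c) +
      map_chain ((#) V0) (frag_extend contraction (bdry (cube_complex (length c)) c))"
    using subset_UNIV[of "Poly_Mapping.keys (bdry (cube_complex (length c)) c)"]
    by (induction rule: frag_induction) (simp_all add: frag_extend_diff)
  then show ?case
    using 3 by (simp add: cube_complex_Suc bdry_chain_Cons)
qed (simp_all add: cube_complex_0 cube_complex_Suc bdry_chain_Cons frag_extend_map_chain
    map_chain_frag_extend)

lemma bdry_frag_extend_contraction:
  assumes "Poly_Mapping.keys c \<subseteq> basis (cube_complex n)"
  shows "bdry_chain (cube_complex n) (frag_extend contraction c) =
    c - frag_cmul (aug_chain (cube_complex n) c) (frag_of (replicate n V0)) -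
    frag_extend contraction (bdry_chain (cube_complex n) c)"
  using assms
proof (induction c rule: frag_induction)
  case (one c)
  then show ?case using bdry_contraction[of c] by (simp add: basis_cube_complex)
qed (simp_all add: frag_extend_diff frag_cmul_diff_distrib)

text \<open>The factor \<open>\<square>\<^sup>m\<close> is mapped onto \<open>\<square>\<^sup>1\<close> by sending all vertices but the last one to \<open>0\<close>, and
  \<open>\<square>\<^sup>1 \<otimes> \<square>\<^sup>n \<rightarrow> \<square>\<^sup>n\<close> is the homotopy given by \<open>contraction\<close>; the recursion does this one
  coordinate at a time.\<close>

fun back_proj :: "nat \<Rightarrow> interval list \<Rightarrow> interval list \<Rightarrow>\<^sub>0 int" where
  "back_proj 0 c = frag_of c"
| "back_proj (Suc m) [] = 0"
| "back_proj (Suc m) (V0 # c) = (if E01 \<in> set c then 0 else frag_of (replicate (length c - m) V0))"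
| "back_proj (Suc m) (V1 # c) = back_proj m c"
| "back_proj (Suc m) (E01 # c) = frag_extend contraction (back_proj m c)"

lemma back_proj_chain_group:
  "length c = m + n \<Longrightarrow> back_proj m c \<in> chain_group (cube_complex n) (deg (cube_complex (m + n)) c)"
proof (induction m c rule: back_proj.induct)
  case (5 m c)
  then have "back_proj m c \<in> chain_group (cube_complex n) (deg (cube_complex (m + n)) c)" by simp
  moreover have "contraction b \<in> chain_group (cube_complex n) (Suc (deg (cube_complex n) b))"
    if "b \<in> basis (cube_complex n)" for b
    using contraction_chain_group[of b] that by (simp add: basis_cube_complex)
  ultimately have "frag_extend contraction (back_proj m c) \<in>
      chain_group (cube_complex n) (Suc (deg (cube_complex (m + n)) c))"
    by (intro frag_extend_chain_group[of "cube_complex n" "deg (cube_complex (m + n)) c"]) metis+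
  then show ?case by (simp add: cube_complex_Suc)
qed (auto simp: chain_group_simps basis_cube_complex cube_complex_Suc deg_cube_complex count_list_0_iff)

lemma positive_back_proj: "positive (back_proj m c)"
  by (induction m c rule: back_proj.induct)
    (simp_all add: positive_simps positive_frag_extend positive_contraction)

lemma aug_back_proj:
  "length c = m + n \<Longrightarrow> aug_chain (cube_complex n) (back_proj m c) = aug (cube_complex (m + n)) c"
proof (induction m c rule: back_proj.induct)
  case (5 m c)
  \<comment> \<open>The image of an edge direction has positive degree, where the augmentation
    vanishes.\<close>
  then have "back_proj (Suc m) (E01 # c) \<in>
      chain_group (cube_complex n) (Suc (deg (cube_complex (m + n)) c))"
    using back_proj_chain_group[of "E01 # c" "Suc m" n] by (simp add: cube_complex_Suc)
  then have "aug_chain (cube_complex n) (back_proj (Suc m) (E01 # c)) = 0"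
    unfolding aug_chain_def
    using augmented_directed_complex.aug_pos_deg[OF cube_complex_adc]
    by (intro sum.neutral) (auto simp: chain_group_def)
  then show ?case by (simp add: cube_complex_Suc)
qed (simp_all add: cube_complex_Suc aug_cube_complex)

text \<open>For \<open>E01 # c\<close> this is the homotopy identity applied to
  \<open>back_proj m c\<close>: the face \<open>V1 # c\<close> gives the identity term and the face
  \<open>V0 # c\<close> the constant term.\<close>

lemma bdry_back_proj:
  "length c = m + n \<Longrightarrow> bdry_chain (cube_complex n) (back_proj m c) =
    frag_extend (back_proj m) (bdry (cube_complex (m + n)) c)"
proof (induction m c rule: back_proj.induct)
  case (1 c)
  have "back_proj 0 = frag_of" by (simp add: fun_eq_iff)
  then show ?case by (simp flip: frag_expansion)
next
  case (3 m c)
  then have c: "length c = m + n" by simp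
  let ?K = "cube_complex (m + n)"
  \<comment> \<open>On the \<open>V0\<close> face the map is the augmentation times the initial
    vertex, so it kills boundaries.\<close>
  have "frag_extend (\<lambda>b. back_proj (Suc m) (V0 # b)) (bdry ?K c) =
      frag_extend (\<lambda>b. frag_cmul (aug ?K b) (frag_of (replicate n V0))) (bdry ?K c)"
    by (rule frag_extend_eq) (use keys_bdry_cube[OF c] in \<open>auto simp: aug_cube_complex\<close>)
  also have "\<dots> = 0"
    using c augmented_directed_complex.aug_bdry[OF cube_complex_adc, of c "m + n"]
    by (simp add: frag_extend_aug basis_cube_complex)
  finally have "frag_extend (\<lambda>b. back_proj (Suc m) (V0 # b)) (bdry ?K c) = 0" .
  then show ?case
    using c by (simp add: cube_complex_Suc frag_extend_map_chain bdry_cube_vertex)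
next
  case (4 m c)
  then show ?case by (simp add: cube_complex_Suc frag_extend_map_chain)
next
  case (5 m c)
  then have c: "length c = m + n" by simp
  let ?K = "cube_complex (m + n)"
  have "Poly_Mapping.keys (back_proj m c) \<subseteq> basis (cube_complex n)"
    using back_proj_chain_group[OF c] by (auto simp: chain_group_def)
  from bdry_frag_extend_contraction[OF this]
  have "bdry_chain (cube_complex n) (back_proj (Suc m) (E01 # c)) =
    back_proj m c - frag_cmul (aug ?K c) (frag_of (replicate n V0)) -
    frag_extend contraction (frag_extend (back_proj m) (bdry ?K c))"
    using 5 by (simp add: aug_back_proj)
  moreover have "back_proj (Suc m) (V0 # c) = frag_cmul (aug ?K c) (frag_of (replicate n V0))"
    using c by (simp add: aug_cube_complex)
  ultimately show ?case
    by (simp add: cube_complex_Suc frag_extend_diff frag_extend_map_chain frag_extend_frag_extend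
        del: back_proj.simps(3))
qed simp

lemma back_proj_functor: "strict_functor (cube (m + n)) (cube n) (nu_extend (back_proj m))"
proof -
  have "strict_functor (nu (cube_complex (m + n))) (nu (cube_complex n)) (nu_extend (back_proj m))"
    by (rule nu_extend_functor)
      (simp_all add: basis_cube_complex back_proj_chain_group positive_back_proj aug_back_proj
        bdry_back_proj)
  then show ?thesis by (simp add: cube_def)
qed

text \<open>The second projection is constant on the first summand, because the contraction kills
  the initial vertex and so every edge coordinate gives 0.\<close>

lemma back_proj_append_V0:
  "back_proj (length a) (a @ replicate n V0) =
    frag_cmul (aug (cube_complex (length a)) a) (frag_of (replicate n V0))"
proof (induction a)
  case (Cons x a)
  then show ?case
    by (cases x) (auto simp: cube_complex_Suc aug_cube_complex frag_extend_cmul contraction_replicate)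
qed (simp add: cube_complex_0)

lemma back_proj_V1_append: "back_proj m (replicate m V1 @ b) = frag_of b"
  by (induction m) simp_all

text \<open>The recursion passes over leading \<open>V1\<close> coordinates and returns the initial
  vertex at the first \<open>V0\<close>, which occurs among the first \<open>m\<close>
  coordinates.\<close>

lemma back_proj_vertex:
  assumes "E01 \<notin> set v" "length v = m + n" "take m v \<noteq> replicate m V1"
  shows "back_proj m v = frag_of (replicate n V0)"
  using assms
proof (induction m v rule: back_proj.induct)
qed auto


section \<open>Loop-freeness of cubes\<close>

definition weigh :: "('b \<Rightarrow> int) \<Rightarrow> ('b \<Rightarrow>\<^sub>0 int) \<Rightarrow> int" where
  "weigh w = aug_chain \<lparr>basis = UNIV, deg = \<lambda>_. 0, bdry = \<lambda>_. 0, aug = w\<rparr>"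

lemma weigh_simps [simp]:
  "weigh w 0 = 0" "weigh w (frag_of b) = w b" "weigh w (x + y) = weigh w x + weigh w y"
  "weigh w (x - y) = weigh w x - weigh w y" "weigh w (frag_cmul k x) = k * weigh w x"
  by (simp_all add: weigh_def)

lemma weigh_map_chain: "weigh w (map_chain \<phi> c) = weigh (\<lambda>b. w (\<phi> b)) c"
  using subset_UNIV[of "Poly_Mapping.keys c"] by (induction c rule: frag_induction) simp_all

lemma weigh_affine: "weigh (\<lambda>b. k + l * w b) c = k * weigh (\<lambda>_. 1) c + l * weigh w c"
  using subset_UNIV[of "Poly_Mapping.keys c"]
  by (induction c rule: frag_induction) (simp_all add: algebra_simps)

lemma weigh_bdry_chain:
  assumes "\<And>b. b \<in> Poly_Mapping.keys c \<Longrightarrow> weigh w (bdry K b) = k"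
  shows "weigh w (bdry_chain K c) = k * weigh (\<lambda>_. 1) c"
proof -
  have "Poly_Mapping.keys c \<subseteq> {b. weigh w (bdry K b) = k}" using assms by blast
  then show ?thesis by (induction c rule: frag_induction) (simp_all add: right_diff_distrib)
qed

lemma weigh_one: "weigh (\<lambda>_. 1) c = (\<Sum>b\<in>Poly_Mapping.keys c. Poly_Mapping.lookup c b)"
  by (simp add: weigh_def aug_chain_def)

lemma weigh_one_nonneg: "positive c \<Longrightarrow> 0 \<le> weigh (\<lambda>_. 1) c"
  by (simp add: weigh_one positive_def sum_nonneg)

lemma positive_eq_0:
  assumes "positive c" "weigh (\<lambda>_. 1) c \<le> 0"
  shows "c = 0"
proof -
  have "(\<Sum>b\<in>Poly_Mapping.keys c. Poly_Mapping.lookup c b) = 0"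
    using assms weigh_one_nonneg[OF assms(1)] by (simp add: weigh_one)
  then have "\<forall>b\<in>Poly_Mapping.keys c. Poly_Mapping.lookup c b = 0"
    using assms(1) by (subst (asm) sum_nonneg_eq_0_iff) (auto simp: positive_def)
  then show ?thesis by (metis all_not_in_conv in_keys_iff keys_eq_empty)
qed

text \<open>Removing one basis element of the support leaves a positive chain with coefficient sum
  0.\<close>

lemma positive_eq_frag_of:
  assumes c: "positive c" and "weigh (\<lambda>_. 1) c = 1"
  obtains b where "c = frag_of b"
proof -
  have "c \<noteq> 0" using assms(2) by auto
  then obtain b where b: "b \<in> Poly_Mapping.keys c" by (metis all_not_in_conv keys_eq_empty)
  then have "1 \<le> Poly_Mapping.lookup c b"
    using c by (simp add: positive_def in_keys_iff) (metis le_less zless_imp_add1_zle add_0)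
  then have "positive (c - frag_of b)" using c by (simp add: positive_def lookup_minus)
  then have "c - frag_of b = 0" by (rule positive_eq_0) (simp add: assms)
  then show ?thesis using that by simp
qed

text \<open>The sign makes every pair of opposite faces contribute \<open>+1\<close> to the weight of a boundary.\<close>

fun cube_weight :: "interval list \<Rightarrow> int" where
  "cube_weight [] = 0"
| "cube_weight (V0 # c) = cube_weight c"
| "cube_weight (V1 # c) = 1 + cube_weight c"
| "cube_weight (E01 # c) = - cube_weight c"

lemma weigh_one_bdry_cube: "length c = n \<Longrightarrow> weigh (\<lambda>_. 1) (bdry (cube_complex n) c) = 0"
proof (induction n arbitrary: c)
  case (Suc n)
  then obtain x c' where c: "c = x # c'" and "length c' = n" by (auto simp: length_Suc_conv)
  then show ?case
    using Suc.IH[of c'] by (cases x) (simp_all add: cube_complex_Suc weigh_map_chain)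
qed (simp add: cube_complex_0)

text \<open>Each edge coordinate contributes 1. A leading \<open>V1\<close> shifts all weights by a
  constant, invisible since boundaries have coefficient sum 0. For a leading \<open>E01\<close> the
  end faces contribute 1, and the sign in the weight cancels the sign in the boundary.\<close>

lemma weigh_bdry_cube:
  "length c = n \<Longrightarrow> weigh cube_weight (bdry (cube_complex n) c) = int (deg (cube_complex n) c)"
proof (induction n arbitrary: c)
  case (Suc n)
  then obtain x c' where c: "c = x # c'" and c': "length c' = n" by (auto simp: length_Suc_conv)
  let ?b = "bdry (cube_complex n) c'"
  have "weigh (\<lambda>b. 1 + cube_weight b) ?b = weigh cube_weight ?b"
    "weigh (\<lambda>b. - cube_weight b) ?b = - weigh cube_weight ?b"
    using weigh_affine[of 1 1 cube_weight ?b] weigh_affine[of 0 "-1" cube_weight ?b]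
      weigh_one_bdry_cube[OF c'] by simp_all
  then show ?case
    using Suc.IH[OF c'] unfolding c by (cases x) (simp_all add: cube_complex_Suc weigh_map_chain)
qed (simp add: cube_complex_0)

text \<open>On a vertex the weight counts the coordinates \<open>V1\<close>, so the bounds are
  attained at the first and the last vertex.\<close>

lemma cube_weight_vertex:
  assumes "E01 \<notin> set v"
  shows "0 \<le> cube_weight v \<and> cube_weight v \<le> int (length v)"
  using assms by (induction v rule: cube_weight.induct) auto

lemma cube_weight_replicate:
  "cube_weight (replicate n V0) = 0" "cube_weight (replicate n V1) = int n"
  by (induction n) simp_all

text \<open>Vertices have augmentation 1, so a positive degree 0 chain of augmentation 1 has
  coefficient sum 1 and is a single vertex.\<close>

lemma nu_cube_vertex:
  assumes x: "x \<in> cells (nu (cube_complex n))"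
  obtains v where "length v = n" "E01 \<notin> set v" "x 0 \<alpha> = frag_of v"
proof -
  have c: "x 0 \<alpha> \<in> chain_group (cube_complex n) 0" and pos: "positive (x 0 \<alpha>)"
    and aug: "aug_chain (cube_complex n) (x 0 \<alpha>) = 1"
    using x by (simp_all add: nu_cells)
  have vertex: "length v = n \<and> E01 \<notin> set v" if "v \<in> Poly_Mapping.keys (x 0 \<alpha>)" for v
    using c that
    by (auto simp: chain_group_def basis_cube_complex deg_cube_complex count_list_0_iff)
  have "aug_chain (cube_complex n) (x 0 \<alpha>) = weigh (\<lambda>_. 1) (x 0 \<alpha>)"
    unfolding weigh_one aug_chain_def by (rule sum.cong) (simp_all add: vertex aug_cube_complex)
  then obtain v where "x 0 \<alpha> = frag_of v" using positive_eq_frag_of[OF pos] aug by metis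
  then show ?thesis using that[of v] vertex[of v] by simp
qed

lemma weigh_bdry_chain_cube:
  assumes "c \<in> chain_group (cube_complex n) k"
  shows "weigh cube_weight (bdry_chain (cube_complex n) c) = int k * weigh (\<lambda>_. 1) c"
  by (rule weigh_bdry_chain)
    (use assms in \<open>auto simp: chain_group_def basis_cube_complex weigh_bdry_cube\<close>)

text \<open>The boundary of a positive chain of degree \<open>k > 0\<close> has weight
  \<open>k\<close> times its coefficient sum, so the chain vanishes once that weight is at most
  0.\<close>

lemma nu_cube_constant:
  assumes x: "x \<in> cells (nu (cube_complex n))"
    and v: "x 0 Minus = frag_of v" and w: "x 0 Plus = frag_of w"
    and le: "cube_weight w \<le> cube_weight v"
  shows "x = nu_vertex v"
proof -
  have c: "x i \<alpha> \<in> chain_group (cube_complex n) i" and pos: "positive (x i \<alpha>)"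
    and bdry: "bdry_chain (cube_complex n) (x (Suc i) \<alpha>) = x i Plus - x i Minus" for i \<alpha>
    using x by (simp_all add: nu_cells)
  have zero: "x (Suc i) \<alpha> = 0" for i \<alpha>
  proof (induction i arbitrary: \<alpha>)
    case 0
    \<comment> \<open>The boundary is \<open>frag_of w - frag_of v\<close>, of nonpositive weight by
      \<open>le\<close>.\<close>
    show ?case
      using weigh_bdry_chain_cube[OF c[of 1 \<alpha>]] bdry[of 0 \<alpha>] le v w
      by (intro positive_eq_0 pos) simp
  next
    case (Suc i)
    have "bdry_chain (cube_complex n) (x (Suc (Suc i)) \<alpha>) = 0" using bdry[of "Suc i" \<alpha>] Suc by simp
    then show ?case
      using weigh_bdry_chain_cube[OF c[of "Suc (Suc i)" \<alpha>]] by (intro positive_eq_0 pos) simp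
  qed
  have "x 0 Plus = x 0 Minus" using bdry[of 0 Plus] zero[of 0 Plus] by simp
  then have "x i \<alpha> = nu_vertex v i \<alpha>" for i \<alpha>
    using zero v by (cases i; cases \<alpha>) (simp_all add: nu_vertex_def)
  then show ?thesis by (intro ext)
qed

lemma nu_bd_eq_vertex: "nu_bd \<alpha> 0 x = nu_vertex v \<Longrightarrow> x 0 \<alpha> = frag_of v"
  by (drule fun_cong[of _ _ 0], drule fun_cong[of _ _ \<alpha>]) (simp add: nu_bd_def nu_vertex_def)

text \<open>The last vertex has the greatest weight, so no target can outweigh it.\<close>

lemma cube_no_exit:
  assumes "x \<in> cells (cube n)" "bd (cube n) Minus 0 x = second_pt (cube n)"
  shows "x = second_pt (cube n)"
proof -
  have x: "x \<in> cells (nu (cube_complex n))" using assms by (simp add: cube_def)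
  obtain w where w: "length w = n" "E01 \<notin> set w" "x 0 Plus = frag_of w"
    using nu_cube_vertex[OF x] by blast
  have "x 0 Minus = frag_of (replicate n V1)" using assms by (simp add: cube_def nu_bd_eq_vertex)
  then have "x = nu_vertex (replicate n V1)"
    using w cube_weight_vertex[of w] by (intro nu_cube_constant[OF x]) (auto simp: cube_weight_replicate)
  then show ?thesis by (simp add: cube_def)
qed

lemma cube_no_entry:
  assumes "x \<in> cells (cube n)" "bd (cube n) Plus 0 x = first_pt (cube n)"
  shows "x = first_pt (cube n)"
proof -
  have x: "x \<in> cells (nu (cube_complex n))" using assms by (simp add: cube_def)
  obtain v where v: "length v = n" "E01 \<notin> set v" "x 0 Minus = frag_of v"
    using nu_cube_vertex[OF x] by blast
  have w: "x 0 Plus = frag_of (replicate n V0)" using assms by (simp add: cube_def nu_bd_eq_vertex)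
  have x_v: "x = nu_vertex v"
    using v w cube_weight_vertex[of v] by (intro nu_cube_constant[OF x]) (auto simp: cube_weight_replicate)
  \<comment> \<open>Constancy was obtained at the source \<open>v\<close>; comparison with the
    target identifies \<open>v\<close> as the first vertex.\<close>
  with w have "v = replicate n V0" by (simp add: nu_vertex_def frag_of_eq)
  with x_v show ?thesis by (simp add: cube_def)
qed

lemma cube_object:
  assumes "is_object (cube n) x"
  obtains v where "length v = n" "E01 \<notin> set v" "x = nu_vertex v"
proof -
  have x: "x \<in> cells (nu (cube_complex n))" and bd: "nu_bd Minus 0 x = x"
    using assms by (simp_all add: is_object_def cube_def)
  obtain v where v: "length v = n" "E01 \<notin> set v" "x 0 Minus = frag_of v"
    using nu_cube_vertex[OF x] by blast
  have "nu_bd Minus 0 x = nu_vertex v" using v by (auto simp: nu_bd_def nu_vertex_def fun_eq_iff)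
  then show ?thesis using that v bd by simp
qed


section \<open>The retraction\<close>

lemma cube_pts:
  "first_pt (cube n) = nu_vertex (replicate n V0)" "second_pt (cube n) = nu_vertex (replicate n V1)"
  by (simp_all add: cube_def)

interpretation cube_factorization:
  wedge_factorization "cube (m + n)" "cube m" "cube n"
    "nu_extend (front_proj m)" "nu_extend (back_proj m)" for m n
proof
  fix z assume "is_object (cube (m + n)) z"
  then obtain v where v: "length v = m + n" "E01 \<notin> set v" "z = nu_vertex v" by (rule cube_object)
  show "nu_extend (front_proj m) z = second_pt (cube m) \<or> nu_extend (back_proj m) z = first_pt (cube n)"
  \<comment> \<open>If the first \<open>m\<close> coordinates are all \<open>V1\<close>, the first
    projection hits the gluing point; otherwise the second does.\<close>
  proof (cases "take m v = replicate m V1")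
    case True
    have "front_proj m v = frag_of (take m v)" using v by (auto simp: front_proj_def dest: in_set_dropD)
    with True show ?thesis by (simp add: v nu_extend_nu_vertex cube_def)
  next
    case False
    then show ?thesis using v back_proj_vertex[of v m n] by (simp add: nu_extend_nu_vertex cube_def)
  qed
qed (simp_all add: bipointed_cube front_proj_functor back_proj_functor cube_no_exit cube_no_entry)

abbreviation cube_join where "cube_join m n \<equiv> cube_factorization.join m n"

text \<open>On this face the first projection is the identity and the second is constant at the
  gluing point.\<close>

lemma cube_join_append_V0:
  assumes x: "x \<in> cells (cube m)"
  shows "cube_join m n (nu_map (\<lambda>a. a @ replicate n V0) x) = wedge_inl (cube m) (cube n) x"
proof -
  have x: "x \<in> cells (nu (cube_complex m))" using x by (simp add: cube_def)
  have "nu_extend (front_proj m) (nu_map (\<lambda>a. a @ replicate n V0) x) = x"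
    unfolding nu_extend_nu_map
    by (rule nu_extend_eq_ident[OF x]) (simp add: front_proj_def basis_cube_complex)
  moreover have "nu_extend (back_proj m) (nu_map (\<lambda>a. a @ replicate n V0) x) =
      nu_vertex (replicate n V0)"
    unfolding nu_extend_nu_map
    by (rule nu_extend_eq_vertex[OF cube_complex_adc x])
      (use back_proj_append_V0 in \<open>auto simp: basis_cube_complex\<close>)
  ultimately show ?thesis by (simp add: cube_factorization.join_inl cube_pts)
qed

lemma cube_join_V1_append:
  assumes y: "y \<in> cells (cube n)"
  shows "cube_join m n (nu_map (\<lambda>b. replicate m V1 @ b) y) = wedge_inr (cube m) (cube n) y"
proof -
  have y: "y \<in> cells (nu (cube_complex n))" using y by (simp add: cube_def)
  have "nu_extend (front_proj m) (nu_map (\<lambda>b. replicate m V1 @ b) y) = nu_vertex (replicate m V1)"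
    unfolding nu_extend_nu_map
    by (rule nu_extend_eq_vertex[OF cube_complex_adc y])
      (simp add: front_proj_def basis_cube_complex aug_cube_complex)
  moreover have "nu_extend (back_proj m) (nu_map (\<lambda>b. replicate m V1 @ b) y) = y"
    unfolding nu_extend_nu_map by (rule nu_extend_eq_ident[OF y]) (simp add: back_proj_V1_append)
  ultimately show ?thesis by (simp add: cube_factorization.join_inr cube_pts)
qed

text \<open>Tensoring with a vertex is a chain map: it has degree 0, zero boundary and augmentation
  1.\<close>

lemma gray_cubes_left_functor:
  "strict_functor (cube m) (gray_cubes m n) (nu_map (\<lambda>a. (a, replicate n V0)))"
  using nu_map_functor[of "cube_complex m" "\<lambda>a. (a, replicate n V0)"
      "tensor (cube_complex m) (cube_complex n)"]
  by (simp add: cube_def gray_cubes_def gray_def cube_complex_vertex bdry_cube_vertex)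

lemma gray_cubes_right_functor:
  "strict_functor (cube n) (gray_cubes m n) (nu_map (\<lambda>b. (replicate m V1, b)))"
  using nu_map_functor[of "cube_complex n" "\<lambda>b. (replicate m V1, b)"
      "tensor (cube_complex m) (cube_complex n)"]
  by (simp add: cube_def gray_cubes_def gray_def cube_complex_vertex bdry_cube_vertex)

theorem theorem3p1:
  fixes m n :: nat
  shows "(\<exists>\<iota> \<rho>. bipointed_map (wedge (cube m) (cube n)) (gray_cubes m n) \<iota> \<and>
                bipointed_map (gray_cubes m n) (wedge (cube m) (cube n)) \<rho> \<and>
                (\<forall>x\<in>cells (wedge (cube m) (cube n)). \<rho> (\<iota> x) = x)) \<and>
         bipointed_iso (gray_cubes m n) (cube (m + n)) (nu_map (\<lambda>(xs, ys). xs @ ys))"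
proof (intro conjI)
  let ?W = "wedge (cube m) (cube n)"
  let ?inl = "wedge_inl (cube m) (cube n)" and ?inr = "wedge_inr (cube m) (cube n)"
  let ?append = "nu_map (\<lambda>(xs, ys). xs @ ys) ::
    (nat \<Rightarrow> polarity \<Rightarrow> interval list \<times> interval list \<Rightarrow>\<^sub>0 int) \<Rightarrow> _"
  let ?u = "nu_map (\<lambda>a. (a, replicate n V0))" and ?v = "nu_map (\<lambda>b. (replicate m V1, b))"
  note cubes = bipointed_cube[of m] bipointed_cube[of n]
  have W: "bipointed ?W" using cubes by (rule bipointed_wedge)
  have pts: "first_pt (cube k) \<in> cells (cube k)" "second_pt (cube k) \<in> cells (cube k)" for k
    using bipointed_cube[of k] by (simp_all add: bipointed_def is_object_def)
  show iso: "bipointed_iso (gray_cubes m n) (cube (m + n)) ?append" by (rule gray_cubes_iso)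
  \<comment> \<open>Both are the vertex with \<open>m\<close> coordinates \<open>V1\<close> followed
    by \<open>n\<close> coordinates \<open>V0\<close>, so the two inclusions glue.\<close>
  have "?u (second_pt (cube m)) = ?v (first_pt (cube n))"
    by (simp add: cube_def nu_map_nu_vertex)
  from wedge_universal[OF cubes gray_cubes_left_functor gray_cubes_right_functor, OF this]
  obtain \<iota> where \<iota>: "strict_functor ?W (gray_cubes m n) \<iota>"
    and inl: "\<And>x. x \<in> cells (cube m) \<Longrightarrow> \<iota> (?inl x) = ?u x"
    and inr: "\<And>y. y \<in> cells (cube n) \<Longrightarrow> \<iota> (?inr y) = ?v y" by blast
  define \<rho> where "\<rho> = (\<lambda>z. cube_join m n (?append z))"
  have "strict_functor (gray_cubes m n) (cube (m + n)) ?append"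
    using iso by (simp add: bipointed_iso_def bipointed_map_def)
  then have \<rho>: "strict_functor (gray_cubes m n) ?W \<rho>"
    unfolding \<rho>_def by (rule strict_functor_compose[OF _ cube_factorization.join_functor])
  have \<rho>_u: "\<rho> (?u x) = ?inl x" if "x \<in> cells (cube m)" for x
    using cube_join_append_V0[OF that] by (simp add: \<rho>_def nu_map_nu_map)
  have \<rho>_v: "\<rho> (?v y) = ?inr y" if "y \<in> cells (cube n)" for y
    using cube_join_V1_append[OF that] by (simp add: \<rho>_def nu_map_nu_map)
  have gray_pts: "first_pt (gray_cubes m n) = ?u (first_pt (cube m))"
    "second_pt (gray_cubes m n) = ?v (second_pt (cube n))"
    by (simp_all add: gray_cubes_def cube_def nu_map_nu_vertex)
  have "bipointed_map ?W (gray_cubes m n) \<iota>"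
    using W bipointed_gray_cubes \<iota> by (simp add: bipointed_map_def wedge_pts gray_pts inl inr pts)
  moreover have "bipointed_map (gray_cubes m n) ?W \<rho>"
    using W bipointed_gray_cubes \<rho> by (simp add: bipointed_map_def wedge_pts gray_pts \<rho>_u \<rho>_v pts)
  moreover have "\<rho> (\<iota> X) = X" if "X \<in> cells ?W" for X
  \<comment> \<open>The composite and the identity are compared on the two summands, where
    \<open>\<rho>_u\<close> and \<open>\<rho>_v\<close> apply.\<close>
  proof (rule wedge_functor_unique[OF cubes _ _ _ _ that])
    show "strict_functor ?W ?W (\<lambda>X. \<rho> (\<iota> X))" using \<iota> \<rho> by (rule strict_functor_compose)
    show "strict_functor ?W ?W (\<lambda>X. X)" using W by (simp add: strict_functor_ident bipointed_def)
  qed (simp_all add: inl inr \<rho>_u \<rho>_v)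
  ultimately show "\<exists>\<iota> \<rho>. bipointed_map ?W (gray_cubes m n) \<iota> \<and> bipointed_map (gray_cubes m n) ?W \<rho> \<and>
      (\<forall>x\<in>cells ?W. \<rho> (\<iota> x) = x)" by blast
qed

end
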